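(* Let $\Phi$ be a field of characteristic zero, let $T\ge 2$ be an integer, and let $A_T$ be the algebra with involution over $\Phi$ defined in the context. Then the $*$-PI-exponent ${\rm exp}^*(A_T)=\lim_{n\to\infty}\sqrt[n]{c_n^*(A_T)}$ exists and $${\rm exp}^*(A_T)=\frac{1}{\theta_T^{\theta_T}(1-\theta_T)^{1-\theta_T}},\qquad\text{where } \theta_T=\frac{1}{2T+1}.$$
   Context: All algebras are over a field $\Phi$ of characteristic zero and are not assumed associative or unital. An involution on $A$ is a $\Phi$-linear map $*\colon A\to A$ with $(a^* )^*=a$ and $(ab)^*=b^*a^*$. Put $A^+=\{a\in A: a^*=a\}$ and $A^-=\{b\in A: b^*=-b\}$. Let $\Phi\{X,Y\}$ be the free nonassociative algebra over $\Phi$ on the free generators $X\cup Y$, $X=\{x_1,x_2,\ldots\}$, $Y=\{y_1,y_2,\ldots\}$. A polynomial $f(x_1,\ldots,x_m,y_1,\ldots,y_r)\in\Phi\{X,Y\}$ is a $*$-identity of $A$ if $f(a_1,\ldots,a_m,b_1,\ldots,b_r)=0$ for all $a_1,\ldots,a_m\in A^+$ and $b_1,\ldots,b_r\in A^-$. Let $Id^*(A)$ be the set of all $*$-identities of $A$. For $0\le k\le n$ let $P^*_{k,n-k}$ be the space of all multilinear polynomials in $x_1,\ldots,x_k,y_1,\ldots,y_{n-k}$. Define $$c^*_{k,n-k}(A)=\dim\frac{P^*_{k,n-k}}{P^*_{k,n-k}\cap Id^*(A)},\qquad c^*_n(A)=\sum_{k=0}^n\binom nk c^*_{k,n-k}(A).$$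 The algebra $A_T$ ($T\ge2$) has basis $\{a,b,z_1,\ldots,z_{2T+1}\}$ and multiplication $$z_ia=az_i=z_{i+1}\ (1\le i\le 2T),\qquad z_{2T+1}b=bz_{2T+1}=z_1,$$ all other products of basis elements being zero. Its involution is the linear map with $a^*=-a$, $b^*=b$, $z_i^*=(-1)^{i+1}z_i$. *)

theory Defs
  imports Complex_Main "HOL-Library.Poly_Mapping" "HOL-Library.Multiset"
begin

section \<open>Dimension of a quotient space\<close>

text \<open>
  \<open>quot_basis s V W B\<close> says that \<open>b \<mapsto> b + W\<close> maps \<open>B \<subseteq> V\<close> injectively onto a basis
  of the quotient space \<open>V/W\<close>: a linear combination of the cosets is zero in \<open>V/W\<close> iff the
  combination of the representatives lies in \<open>W\<close>.
\<close>

definition quot_basis ::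
    "('k::field \<Rightarrow> 'v::ab_group_add \<Rightarrow> 'v) \<Rightarrow> 'v set \<Rightarrow> 'v set \<Rightarrow> 'v set \<Rightarrow> bool" where
  "quot_basis s V W B \<longleftrightarrow>
     B \<subseteq> V \<and>
     (\<forall>S c. finite S \<and> S \<subseteq> B \<and> (\<Sum>b\<in>S. s (c b) b) \<in> W \<longrightarrow> (\<forall>b\<in>S. c b = 0)) \<and>
     (\<forall>v\<in>V. \<exists>S c. finite S \<and> S \<subseteq> B \<and> v - (\<Sum>b\<in>S. s (c b) b) \<in> W)"

definition quot_dim ::
    "('k::field \<Rightarrow> 'v::ab_group_add \<Rightarrow> 'v) \<Rightarrow> 'v set \<Rightarrow> 'v set \<Rightarrow> nat" where
  "quot_dim s V W = card (SOME B. quot_basis s V W B)"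


section \<open>Free modules\<close>

definition pm_scale :: "'k::comm_ring_1 \<Rightarrow> ('i \<Rightarrow>\<^sub>0 'k) \<Rightarrow> ('i \<Rightarrow>\<^sub>0 'k)" where
  "pm_scale c = Poly_Mapping.map ((*) c)"

lemma lookup_pm_scale [simp]: "Poly_Mapping.lookup (pm_scale c p) i = c * Poly_Mapping.lookup p i"
  by (simp add: pm_scale_def Poly_Mapping.map.rep_eq when_def)

global_interpretation pm: vector_space "pm_scale :: 'k::field \<Rightarrow> ('i \<Rightarrow>\<^sub>0 'k) \<Rightarrow> _"
  by unfold_locales (auto intro!: poly_mapping_eqI simp: lookup_add algebra_simps)

definition lin_ext :: "('i \<Rightarrow> ('j \<Rightarrow>\<^sub>0 'k::comm_ring_1)) \<Rightarrow> ('i \<Rightarrow>\<^sub>0 'k) \<Rightarrow> ('j \<Rightarrow>\<^sub>0 'k)" where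
  "lin_ext g p = (\<Sum>i\<in>Poly_Mapping.keys p. pm_scale (Poly_Mapping.lookup p i) (g i))"

definition bilin_ext ::
    "('i \<Rightarrow> 'i \<Rightarrow> ('j \<Rightarrow>\<^sub>0 'k::comm_ring_1)) \<Rightarrow> ('i \<Rightarrow>\<^sub>0 'k) \<Rightarrow> ('i \<Rightarrow>\<^sub>0 'k) \<Rightarrow> ('j \<Rightarrow>\<^sub>0 'k)" where
  "bilin_ext g p q =
     (\<Sum>i\<in>Poly_Mapping.keys p. \<Sum>j\<in>Poly_Mapping.keys q.
        pm_scale (Poly_Mapping.lookup p i * Poly_Mapping.lookup q j) (g i j))"


section \<open>Nonassociative algebras with involution\<close>

text \<open>The underlying space is a subspace \<open>carrier\<close> of an ambient vector space.\<close>

record ('k, 'v) star_alg =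
  carrier :: "'v set"
  scale :: "'k \<Rightarrow> 'v \<Rightarrow> 'v"
  mult :: "'v \<Rightarrow> 'v \<Rightarrow> 'v"
  star :: "'v \<Rightarrow> 'v"

locale star_algebra = vector_space "scale A"
  for A :: "('k::field, 'v::ab_group_add) star_alg" +
  assumes subspace_carrier: "subspace (carrier A)"
    and mult_closed: "\<lbrakk>u \<in> carrier A; v \<in> carrier A\<rbrakk> \<Longrightarrow> mult A u v \<in> carrier A"
    and mult_add_left: "\<lbrakk>u \<in> carrier A; v \<in> carrier A; w \<in> carrier A\<rbrakk> \<Longrightarrow>
          mult A (u + v) w = mult A u w + mult A v w"
    and mult_add_right: "\<lbrakk>u \<in> carrier A; v \<in> carrier A; w \<in> carrier A\<rbrakk> \<Longrightarrow>
          mult A u (v + w) = mult A u v + mult A u w"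
    and mult_scale_left: "\<lbrakk>u \<in> carrier A; v \<in> carrier A\<rbrakk> \<Longrightarrow>
          mult A (scale A c u) v = scale A c (mult A u v)"
    and mult_scale_right: "\<lbrakk>u \<in> carrier A; v \<in> carrier A\<rbrakk> \<Longrightarrow>
          mult A u (scale A c v) = scale A c (mult A u v)"
    and star_closed: "u \<in> carrier A \<Longrightarrow> star A u \<in> carrier A"
    and star_add: "\<lbrakk>u \<in> carrier A; v \<in> carrier A\<rbrakk> \<Longrightarrow> star A (u + v) = star A u + star A v"
    and star_scale: "u \<in> carrier A \<Longrightarrow> star A (scale A c u) = scale A c (star A u)"
    and star_star: "u \<in> carrier A \<Longrightarrow> star A (star A u) = u"
    and star_mult: "\<lbrakk>u \<in> carrier A; v \<in> carrier A\<rbrakk> \<Longrightarrow>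
          star A (mult A u v) = mult A (star A v) (star A u)"

definition sym_part :: "('k, 'v) star_alg \<Rightarrow> 'v set" where
  "sym_part A = {u \<in> carrier A. star A u = u}"

definition skew_part :: "('k, 'v::uminus) star_alg \<Rightarrow> 'v set" where
  "skew_part A = {u \<in> carrier A. star A u = - u}"


section \<open>The free nonassociative algebra\<close>

text \<open>Indices are shifted by one: \<open>X i\<close> and \<open>Y i\<close> stand for $x_{i+1}$ and $y_{i+1}$.\<close>

datatype gen = X nat | Y nat

text \<open>
  Nonassociative monomials; there is no empty monomial, as the free algebra has no unit.
\<close>

datatype mono = Gen gen | Mul mono mono

type_synonym 'k free_alg = "mono \<Rightarrow>\<^sub>0 'k"

definition free_mult :: "'k::comm_ring_1 free_alg \<Rightarrow> 'k free_alg \<Rightarrow> 'k free_alg" where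
  "free_mult = bilin_ext (\<lambda>u v. Poly_Mapping.single (Mul u v) 1)"

primrec mono_eval :: "('k, 'v) star_alg \<Rightarrow> (gen \<Rightarrow> 'v) \<Rightarrow> mono \<Rightarrow> 'v" where
  "mono_eval A \<rho> (Gen g) = \<rho> g"
| "mono_eval A \<rho> (Mul u v) = mult A (mono_eval A \<rho> u) (mono_eval A \<rho> v)"

definition poly_eval ::
    "('k::zero, 'v::comm_monoid_add) star_alg \<Rightarrow> (gen \<Rightarrow> 'v) \<Rightarrow> 'k free_alg \<Rightarrow> 'v" where
  "poly_eval A \<rho> f =
     (\<Sum>w\<in>Poly_Mapping.keys f. scale A (Poly_Mapping.lookup f w) (mono_eval A \<rho> w))"


section \<open>Identities with involution and their codimensions\<close>

definition star_identities :: "('k::zero, 'v::ab_group_add) star_alg \<Rightarrow> 'k free_alg set" where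
  "star_identities A =
     {f. \<forall>\<rho>. (\<forall>i. \<rho> (X i) \<in> sym_part A) \<and> (\<forall>i. \<rho> (Y i) \<in> skew_part A)
          \<longrightarrow> poly_eval A \<rho> f = 0}"

primrec gens :: "mono \<Rightarrow> gen multiset" where
  "gens (Gen g) = {#g#}"
| "gens (Mul u v) = gens u + gens v"

definition multilin :: "nat \<Rightarrow> nat \<Rightarrow> 'k::zero free_alg set" where
  "multilin k m =
     {f. \<forall>w\<in>Poly_Mapping.keys f. gens w = mset_set (X ` {..<k} \<union> Y ` {..<m})}"

definition star_codim2 :: "('k::field, 'v::ab_group_add) star_alg \<Rightarrow> nat \<Rightarrow> nat \<Rightarrow> nat" where
  "star_codim2 A k m = quot_dim pm_scale (multilin k m) (multilin k m \<inter> star_identities A)"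

definition star_codim :: "('k::field, 'v::ab_group_add) star_alg \<Rightarrow> nat \<Rightarrow> nat" where
  "star_codim A n = (\<Sum>k=0..n. (n choose k) * star_codim2 A k (n - k))"

definition star_exp_seq :: "('k::field, 'v::ab_group_add) star_alg \<Rightarrow> nat \<Rightarrow> real" where
  "star_exp_seq A n = root n (real (star_codim A n))"

definition star_exp :: "('k::field, 'v::ab_group_add) star_alg \<Rightarrow> real" where
  "star_exp A = lim (star_exp_seq A)"


section \<open>The algebras \<open>A\<^sub>T\<close>\<close>

datatype at_idx = BA | BB | BZ nat

definition at_basis :: "nat \<Rightarrow> at_idx set" where
  "at_basis T = {BA, BB} \<union> BZ ` {1..2*T+1}"

definition at_mult :: "nat \<Rightarrow> at_idx \<Rightarrow> at_idx \<Rightarrow> (at_idx \<Rightarrow>\<^sub>0 'k::comm_ring_1)" where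
  "at_mult T u v =
     (case (u, v) of
        (BZ i, BA) \<Rightarrow> if 1 \<le> i \<and> i \<le> 2*T then Poly_Mapping.single (BZ (i+1)) 1 else 0
      | (BA, BZ i) \<Rightarrow> if 1 \<le> i \<and> i \<le> 2*T then Poly_Mapping.single (BZ (i+1)) 1 else 0
      | (BZ i, BB) \<Rightarrow> if i = 2*T+1 then Poly_Mapping.single (BZ 1) 1 else 0
      | (BB, BZ i) \<Rightarrow> if i = 2*T+1 then Poly_Mapping.single (BZ 1) 1 else 0
      | _ \<Rightarrow> 0)"

primrec at_star :: "at_idx \<Rightarrow> (at_idx \<Rightarrow>\<^sub>0 'k::comm_ring_1)" where
  "at_star BA = Poly_Mapping.single BA (-1)"
| "at_star BB = Poly_Mapping.single BB 1"
| "at_star (BZ i) = Poly_Mapping.single (BZ i) ((-1) ^ (i+1))"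

definition A_T :: "nat \<Rightarrow> ('k::field, at_idx \<Rightarrow>\<^sub>0 'k) star_alg" where
  "A_T T = \<lparr>carrier = {p. Poly_Mapping.keys p \<subseteq> at_basis T},
            scale = pm_scale,
            mult = bilin_ext (at_mult T),
            star = lin_ext at_star\<rparr>"


section \<open>\<open>A\<^sub>T\<close> is an algebra with involution\<close>

lemma lin_ext_superset:
  assumes "finite I" "Poly_Mapping.keys p \<subseteq> I"
  shows "lin_ext g p = (\<Sum>i\<in>I. pm_scale (Poly_Mapping.lookup p i) (g i :: _ \<Rightarrow>\<^sub>0 'k::field))"
  unfolding lin_ext_def using assms
  by (intro sum.mono_neutral_left) (auto simp: in_keys_iff)

lemma lin_ext_add: "lin_ext g (p + q) = lin_ext g p + (lin_ext g q :: _ \<Rightarrow>\<^sub>0 'k::field)"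
  using Poly_Mapping.keys_add[of p q]
  by (simp add: lin_ext_superset[where I="Poly_Mapping.keys p \<union> Poly_Mapping.keys q"] lookup_add
      pm.scale_left_distrib sum.distrib)

lemma lin_ext_scale: "lin_ext g (pm_scale c p) = pm_scale c (lin_ext g p :: _ \<Rightarrow>\<^sub>0 'k::field)"
proof -
  have "Poly_Mapping.keys (pm_scale c p) \<subseteq> Poly_Mapping.keys p" by (auto simp: in_keys_iff)
  then show ?thesis
    by (simp add: lin_ext_superset[where I="Poly_Mapping.keys p"] pm.scale_sum_right)
qed

lemma lin_ext_sum: "lin_ext g (\<Sum>i\<in>I. f i) = (\<Sum>i\<in>I. lin_ext g (f i) :: _ \<Rightarrow>\<^sub>0 'k::field)"
  by (induction I rule: infinite_finite_induct) (auto simp: lin_ext_add, auto simp: lin_ext_def)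

lemma bilin_ext_lin: "bilin_ext g p q = lin_ext (\<lambda>i. lin_ext (g i) q) (p :: _ \<Rightarrow>\<^sub>0 'k::field)"
  by (simp add: bilin_ext_def lin_ext_def pm.scale_sum_right)

lemma lin_ext_fun_add: "lin_ext (\<lambda>i. g i + h i) p = lin_ext g p + lin_ext h (p :: _ \<Rightarrow>\<^sub>0 'k::field)"
  by (simp add: lin_ext_def pm.scale_right_distrib sum.distrib)

lemma lin_ext_fun_scale: "lin_ext (\<lambda>i. pm_scale c (g i)) p = pm_scale c (lin_ext g (p :: _ \<Rightarrow>\<^sub>0 'k::field))"
  by (simp add: lin_ext_def pm.scale_sum_right mult.commute)

definition at_sign :: "at_idx \<Rightarrow> 'k::comm_ring_1" where
  "at_sign u = (case u of BA \<Rightarrow> -1 | BB \<Rightarrow> 1 | BZ i \<Rightarrow> (-1)^(i+1))"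

lemma at_star_sign: "at_star u = Poly_Mapping.single u (at_sign u)"
  by (cases u) (auto simp: at_sign_def)

lemma lookup_star: "Poly_Mapping.lookup (lin_ext at_star p) u = at_sign u * Poly_Mapping.lookup (p :: _ \<Rightarrow>\<^sub>0 'k::field) u"
  by (auto simp: lin_ext_def lookup_sum at_star_sign lookup_single when_def in_keys_iff sum.delta' sum.delta if_distrib cong: if_cong)

lemma at_sign_sq: "at_sign u * (at_sign u * x) = (x :: 'k::field)"
proof -
  have "at_sign u * at_sign u = (1::'k)" by (cases u) (auto simp: at_sign_def power_mult_distrib[symmetric])
  then show ?thesis by (metis mult.assoc mult_1)
qed

lemma at_star_mult: "lin_ext at_star (at_mult T i j) = pm_scale (at_sign i * at_sign j) (at_mult T j i :: _ \<Rightarrow>\<^sub>0 'k::field)"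
  by (rule poly_mapping_eqI)
     (auto simp: lookup_star at_mult_def lookup_single when_def at_sign_def split: at_idx.splits)

lemma keys_lin_ext: "(\<And>i. i \<in> Poly_Mapping.keys p \<Longrightarrow> Poly_Mapping.keys (g i) \<subseteq> S) \<Longrightarrow>
   Poly_Mapping.keys (lin_ext g (p :: _ \<Rightarrow>\<^sub>0 'k::field)) \<subseteq> S"
proof
  assume h: "\<And>i. i \<in> Poly_Mapping.keys p \<Longrightarrow> Poly_Mapping.keys (g i) \<subseteq> S"
  fix x assume "x \<in> Poly_Mapping.keys (lin_ext g p)"
  then have "(\<Sum>i\<in>Poly_Mapping.keys p. Poly_Mapping.lookup p i * Poly_Mapping.lookup (g i) x) \<noteq> 0"
    by (simp add: lin_ext_def in_keys_iff lookup_sum)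
  then obtain i where "i \<in> Poly_Mapping.keys p" "Poly_Mapping.lookup (g i) x \<noteq> 0"
    by (metis (no_types, lifting) mult_zero_right sum.neutral)
  then show "x \<in> S" using h[of i] by (auto simp: in_keys_iff)
qed

lemma keys_at_mult: "Poly_Mapping.keys (at_mult T i j :: _ \<Rightarrow>\<^sub>0 'k::field) \<subseteq> at_basis T"
  by (auto simp: at_mult_def at_basis_def split: at_idx.splits if_splits)

lemma star_mult_AT: "lin_ext at_star (bilin_ext (at_mult T) u v) =
   bilin_ext (at_mult T) (lin_ext at_star v) (lin_ext at_star (u :: _ \<Rightarrow>\<^sub>0 'k::field))"
proof -
  have k: "Poly_Mapping.keys (lin_ext at_star p) \<subseteq> Poly_Mapping.keys p" for p :: "_ \<Rightarrow>\<^sub>0 'k"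
    by (auto simp: in_keys_iff lookup_star)
  have "lin_ext at_star (bilin_ext (at_mult T) u v) = (\<Sum>i\<in>Poly_Mapping.keys u. \<Sum>j\<in>Poly_Mapping.keys v.
     pm_scale (Poly_Mapping.lookup u i * Poly_Mapping.lookup v j * (at_sign i * at_sign j)) (at_mult T j i))"
    by (simp add: bilin_ext_def lin_ext_sum lin_ext_scale at_star_mult)
  also have "\<dots> = (\<Sum>j\<in>Poly_Mapping.keys v. \<Sum>i\<in>Poly_Mapping.keys u. 
     pm_scale (Poly_Mapping.lookup (lin_ext at_star v) j * Poly_Mapping.lookup (lin_ext at_star u) i) (at_mult T j i))"
    by (subst sum.swap) (simp add: lookup_star mult_ac)
  also have "\<dots> = bilin_ext (at_mult T) (lin_ext at_star v) (lin_ext at_star u)"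
    unfolding bilin_ext_lin lin_ext_superset[OF finite_keys k]
    by (simp add: lin_ext_superset[OF finite_keys k] pm.scale_sum_right)
  finally show ?thesis .
qed

lemma star_algebra_A_T: "star_algebra (A_T T :: ('k::field, _) star_alg)"
proof -
  have sc: "scale (A_T T :: ('k, _) star_alg) = pm_scale" by (simp add: A_T_def)
  interpret vector_space "scale (A_T T :: ('k, _) star_alg)" unfolding sc by (rule pm.vector_space_axioms)
  show ?thesis
  proof (unfold_locales, goal_cases)
    case 1
    have "p + q \<in> carrier (A_T T)" if "p \<in> carrier (A_T T)" "q \<in> carrier (A_T T)" for p q :: "at_idx \<Rightarrow>\<^sub>0 'k"
      using that Poly_Mapping.keys_add[of p q] by (auto simp: A_T_def)
    moreover have "pm_scale c p \<in> carrier (A_T T)" if "p \<in> carrier (A_T T)" for c and p :: "at_idx \<Rightarrow>\<^sub>0 'k"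
      using that by (auto simp: A_T_def in_keys_iff)
    moreover have "0 \<in> carrier (A_T T :: ('k, _) star_alg)" by (simp add: A_T_def)
    ultimately show ?case unfolding sc pm.subspace_def by (intro conjI ballI allI)
  next case (2 u v)
    have "Poly_Mapping.keys (bilin_ext (at_mult T) u v) \<subseteq> at_basis T"
      unfolding bilin_ext_lin by (rule keys_lin_ext, rule keys_lin_ext, rule keys_at_mult)
    then show ?case by (simp add: A_T_def)
  next case 3 then show ?case by (simp add: A_T_def bilin_ext_lin lin_ext_add)
  next case 4 then show ?case by (simp add: A_T_def bilin_ext_lin lin_ext_add lin_ext_fun_add)
  next case 5 then show ?case by (simp add: A_T_def bilin_ext_lin lin_ext_scale)
  next case 6 then show ?case by (simp add: A_T_def bilin_ext_lin lin_ext_scale lin_ext_fun_scale)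
  next case 7 then show ?case by (auto simp: A_T_def in_keys_iff lookup_star)
  next case 8 show ?case by (simp add: A_T_def lin_ext_add)
  next case 9 show ?case by (simp add: A_T_def lin_ext_scale)
  next case (10 u)
    have "lin_ext at_star (lin_ext at_star u) = u" by (rule poly_mapping_eqI) (simp add: lookup_star at_sign_sq)
    then show ?case by (simp add: A_T_def)
  next case 11 show ?case by (simp add: A_T_def star_mult_AT)
  qed
qed


section \<open>Evaluation is a homomorphism from the free algebra\<close>

context star_algebra begin

lemma mult_0: "u \<in> carrier A \<Longrightarrow> mult A 0 u = 0" "u \<in> carrier A \<Longrightarrow> mult A u 0 = 0"
  using mult_scale_left[of 0 u 0] mult_scale_right[of u 0 0] subspace_0[OF subspace_carrier] by auto

lemma mult_sum_left: "(\<And>i. i \<in> I \<Longrightarrow> f i \<in> carrier A) \<Longrightarrow> v \<in> carrier A \<Longrightarrow>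
   mult A (sum f I) v = (\<Sum>i\<in>I. mult A (f i) v)"
  by (induction I rule: infinite_finite_induct)
    (auto simp: mult_0 mult_add_left subspace_sum[OF subspace_carrier])

lemma mult_sum_right: "(\<And>i. i \<in> I \<Longrightarrow> f i \<in> carrier A) \<Longrightarrow> v \<in> carrier A \<Longrightarrow>
   mult A v (sum f I) = (\<Sum>i\<in>I. mult A v (f i))"
  by (induction I rule: infinite_finite_induct)
    (auto simp: mult_0 mult_add_right subspace_sum[OF subspace_carrier])

lemma mono_eval_closed: "(\<And>g. \<rho> g \<in> carrier A) \<Longrightarrow> mono_eval A \<rho> w \<in> carrier A"
  by (induction w) (auto intro: mult_closed)

lemma poly_eval_superset: "finite I \<Longrightarrow> Poly_Mapping.keys f \<subseteq> I \<Longrightarrow>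
   poly_eval A \<rho> f = (\<Sum>w\<in>I. scale A (Poly_Mapping.lookup f w) (mono_eval A \<rho> w))"
  unfolding poly_eval_def by (intro sum.mono_neutral_left) (auto simp: in_keys_iff)

lemma poly_eval_add: "poly_eval A \<rho> (f + g) = poly_eval A \<rho> f + poly_eval A \<rho> g"
  using Poly_Mapping.keys_add[of f g]
  by (simp add: poly_eval_superset[where I="Poly_Mapping.keys f \<union> Poly_Mapping.keys g"] lookup_add
      scale_left_distrib sum.distrib)

lemma poly_eval_scale: "poly_eval A \<rho> (pm_scale c f) = scale A c (poly_eval A \<rho> f)"
proof -
  have "Poly_Mapping.keys (pm_scale c f) \<subseteq> Poly_Mapping.keys f" by (auto simp: in_keys_iff)
  then show ?thesis
    by (simp add: poly_eval_superset[where I="Poly_Mapping.keys f"] scale_sum_right)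
qed

lemma poly_eval_sum: "poly_eval A \<rho> (sum f I) = (\<Sum>i\<in>I. poly_eval A \<rho> (f i))"
  by (induction I rule: infinite_finite_induct) (auto simp: poly_eval_add, auto simp: poly_eval_def)

lemma poly_eval_single: "poly_eval A \<rho> (Poly_Mapping.single w 1) = mono_eval A \<rho> w"
  by (simp add: poly_eval_def)

lemma poly_eval_mult:
  assumes "\<And>g. \<rho> g \<in> carrier A"
  shows "poly_eval A \<rho> (free_mult f g) = mult A (poly_eval A \<rho> f) (poly_eval A \<rho> g)"
proof -
  have "poly_eval A \<rho> (free_mult f g) = (\<Sum>i\<in>Poly_Mapping.keys f. \<Sum>j\<in>Poly_Mapping.keys g. 
     scale A (Poly_Mapping.lookup f i * Poly_Mapping.lookup g j) (mult A (mono_eval A \<rho> i) (mono_eval A \<rho> j)))"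
    by (simp add: free_mult_def bilin_ext_def poly_eval_sum poly_eval_scale poly_eval_single)
  also have "\<dots> = mult A (poly_eval A \<rho> f) (poly_eval A \<rho> g)"
    using mono_eval_closed[OF assms]
    by (subst sum.swap) (simp add: poly_eval_def mult_sum_left mult_sum_right mult_scale_left mult_scale_right scale_sum_right mult.commute
       subspace_sum[OF subspace_carrier] subspace_scale[OF subspace_carrier])
  finally show ?thesis .
qed

end


section \<open>Existence of quotient bases and the dimension formula\<close>

context vector_space begin

lemma quot_basis_lift:
  assumes V: "subspace V" and W: "subspace W" "W \<subseteq> V"
    and C: "independent C" "span C = W" and B: "quot_basis scale V W B"
  shows "B \<inter> C = {}" "independent (B \<union> C)" "span (B \<union> C) = V"
proof -
  have BV: "B \<subseteq> V" using B by (simp add: quot_basis_def)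
  have ind: "\<forall>b\<in>S. c b = 0" if "finite S" "S \<subseteq> B" "(\<Sum>b\<in>S. scale (c b) b) \<in> W" for S c
    using B that unfolding quot_basis_def by blast
  have CW: "C \<subseteq> W" using C span_superset by auto
  show dj: "B \<inter> C = {}"
  proof (rule ccontr)
    assume "B \<inter> C \<noteq> {}"
    then obtain b where "b \<in> B" "b \<in> C" by auto
    then show False using ind[of "{b}" "\<lambda>_. 1"] CW by auto
  qed
  show "independent (B \<union> C)"
    unfolding independent_explicit_finite_subsets
  proof (intro allI ballI impI)
    fix S u v assume S: "S \<subseteq> B \<union> C" "finite S" and z: "(\<Sum>v\<in>S. scale (u v) v) = 0" and v: "v \<in> S"
    have Sp: "S = (S \<inter> B) \<union> (S \<inter> C)" using S by auto
    have eq: "(\<Sum>v\<in>S \<inter> B. scale (u v) v) + (\<Sum>v\<in>S \<inter> C. scale (u v) v) = 0"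
      using z S dj by (subst (asm) Sp, subst (asm) sum.union_disjoint) auto
    have "(\<Sum>v\<in>S \<inter> C. scale (u v) v) \<in> W"
      using CW by (intro subspace_sum[OF W(1)] subspace_scale[OF W(1)]) auto
    then have "(\<Sum>v\<in>S \<inter> B. scale (u v) v) \<in> W"
      using eq subspace_neg[OF W(1)] by (metis add_eq_0_iff2)
    then have b0: "\<forall>b\<in>S \<inter> B. u b = 0" using ind[of "S \<inter> B" u] S by auto
    then have "(\<Sum>v\<in>S \<inter> C. scale (u v) v) = 0" using eq by simp
    then have "\<forall>b\<in>S \<inter> C. u b = 0"
      using C(1) S unfolding independent_explicit_finite_subsets by (metis finite_Int inf_le2)
    then show "u v = 0" using b0 v S by auto
  qed
  show "span (B \<union> C) = V"
  proof
    show "span (B \<union> C) \<subseteq> V" using span_minimal[OF _ V] BV CW W by auto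
    show "V \<subseteq> span (B \<union> C)"
    proof
      fix v assume "v \<in> V"
      have "\<forall>v\<in>V. \<exists>S c. finite S \<and> S \<subseteq> B \<and> v - (\<Sum>b\<in>S. scale (c b) b) \<in> W"
        using B unfolding quot_basis_def by (elim conjE)
      from bspec[OF this \<open>v \<in> V\<close>]
      obtain S c where S: "finite S" "S \<subseteq> B" "v - (\<Sum>b\<in>S. scale (c b) b) \<in> W"
        by (elim exE conjE)
      have "v - (\<Sum>b\<in>S. scale (c b) b) \<in> span (B \<union> C)" 
        using S(3) unfolding C(2)[symmetric] by (rule subsetD[OF span_mono, rotated]) simp
      moreover have "(\<Sum>b\<in>S. scale (c b) b) \<in> span (B \<union> C)"
        using S by (intro span_sum span_scale span_base) auto
      ultimately show "v \<in> span (B \<union> C)" by (metis diff_add_cancel span_add)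
    qed
  qed
qed

lemma quot_basis_exists:
  assumes V: "subspace V" and W: "subspace W" "W \<subseteq> V"
  shows "\<exists>B. quot_basis scale V W B"
proof -
  obtain C where C: "C \<subseteq> W" "independent C" "W \<subseteq> span C" by (meson maximal_independent_subset)
  then have CW: "span C = W" using span_minimal[OF C(1) W(1)] by auto
  obtain D where D: "C \<subseteq> D" "D \<subseteq> V" "independent D" "V \<subseteq> span D"
    using maximal_independent_subset_extend[of C V] C W by (metis subset_trans)
  have "quot_basis scale V W (D - C)" unfolding quot_basis_def
  proof (intro conjI allI impI ballI, goal_cases)
    case 1 then show ?case using D by auto
  next
    case (2 S c b)
    then have S: "finite S" "S \<subseteq> D - C" "(\<Sum>b\<in>S. scale (c b) b) \<in> span C" using CW by auto
    from S(3) obtain t r where t: "finite t" "t \<subseteq> C" "(\<Sum>b\<in>S. scale (c b) b) = (\<Sum>a\<in>t. scale (r a) a)"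
      unfolding span_explicit by auto
    let ?u = "\<lambda>x. if x \<in> S then c x else - r x"
    have "(\<Sum>x\<in>S \<union> t. scale (?u x) x) = (\<Sum>x\<in>S. scale (?u x) x) + (\<Sum>x\<in>t. scale (?u x) x)"
      using S t by (intro sum.union_disjoint) auto
    also have "(\<Sum>x\<in>t. scale (?u x) x) = - (\<Sum>a\<in>t. scale (r a) a)"
      using S t by (subst sum_negf[symmetric], intro sum.cong) auto
    finally have "(\<Sum>x\<in>S \<union> t. scale (?u x) x) = 0" using t by simp
    moreover have "S \<union> t \<subseteq> D" "finite (S \<union> t)" "b \<in> S \<union> t" using S t D(1) 2(2) by auto
    ultimately have "?u b = 0" using D(3)[unfolded independent_explicit_finite_subsets, rule_format, of "S \<union> t" ?u b] by blast
    then show ?case using 2 by auto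
  next
    case (3 v)
    then have "v \<in> span ((D - C) \<union> C)" using D by (auto simp: Un_absorb2)
    then obtain x y where "v = x + y" "x \<in> span (D - C)" "y \<in> span C" unfolding span_Un by auto
    moreover from this obtain t r where "finite t" "t \<subseteq> D - C" "x = (\<Sum>a\<in>t. scale (r a) a)"
      unfolding span_explicit[of "D - C"] by auto
    ultimately show ?case using CW by (intro exI[of _ t] exI[of _ r]) auto
  qed
  then show ?thesis ..
qed

lemma quot_dim_eq:
  assumes V: "subspace V" and W: "subspace W" "W \<subseteq> V" and fin: "finite F" "V \<subseteq> span F"
  shows "quot_dim scale V W = dim V - dim W"
proof -
  obtain C where C: "C \<subseteq> W" "independent C" "W \<subseteq> span C" by (meson maximal_independent_subset)
  then have CW: "span C = W" using span_minimal[OF C(1) W(1)] by auto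
  have *: "card B = dim V - dim W" if "quot_basis scale V W B" for B
  proof -
    note q = quot_basis_lift[OF V W C(2) CW that]
    have "finite (B \<union> C)" using independent_span_bound[OF fin(1) q(2)] q(3) fin(2) span_superset by blast
    then have "card (B \<union> C) = card B + card C" using q(1) by (auto intro: card_Un_disjoint)
    moreover have "dim V = card (B \<union> C)" using q by (metis dim_span_eq_card_independent)
    moreover have "dim W = card C" using C(2) CW by (metis dim_span_eq_card_independent)
    ultimately show ?thesis by simp
  qed
  show ?thesis unfolding quot_dim_def using someI_ex[OF quot_basis_exists[OF V W]] * by blast
qed
end

end

theory Submission
  imports Defs
begin

text \<open>
  A product of basis elements of \<open>A\<^sub>T\<close> vanishes unless it contains exactly one factor \<open>z\<^sub>i\<close>, and
  then the symmetric generators other than this factor must be sent to \<open>b\<close>, the skew ones to \<open>a\<close>.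
  So a multilinear polynomial of degree $n \ge 2$ is an identity iff it vanishes under the at most
  $n(2T+1)$ substitutions given by the choice of the \<open>z\<close>-variable and of \<open>i\<close>; this bounds
  $c^*_{k,n-k}$ polynomially. As one \<open>b\<close> is read on each turn around the cycle of the \<open>z\<^sub>i\<close>,
  $c^*_{k,n-k} = 0$ unless $|k - \theta n|$ is bounded, while it is positive for
  $k = \lfloor \theta n \rfloor$. Hence $c^*_n$ is, up to polynomial factors, the binomial coefficient
  $\binom{n}{\lfloor \theta n \rfloor}$. Its growth is read off the binomial distribution with
  success probability $\theta$: every term is at most $1$, and the term at $\lfloor \theta n \rfloor$
  is maximal, hence at least $1/(n+1)$.
\<close>

section \<open>Bounding the dimension of a quotient\<close>

text \<open>The values \<open>\<phi> j v\<close> for \<open>j\<close> in \<open>J\<close> form a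
  vector \<open>\<Phi> v\<close> in the free module on \<open>J\<close>, and \<open>\<Phi>\<close>
  kills no element of \<open>V\<close> outside \<open>W\<close>. Independence of \<open>B\<close>
  modulo \<open>W\<close> therefore passes to the images, which live in a space of dimension
  \<open>card J\<close>.\<close>

lemma (in vector_space) quot_basis_card_le:
  fixes \<phi> :: "'j \<Rightarrow> 'b \<Rightarrow> 'a"
  assumes B: "quot_basis scale V W B" and V: "subspace V" and J: "finite J"
    and add: "\<And>j u v. \<phi> j (u + v) = \<phi> j u + \<phi> j v"
    and scl: "\<And>j c v. \<phi> j (scale c v) = c * \<phi> j v"
    and ker: "\<And>v. v \<in> V \<Longrightarrow> (\<And>j. j \<in> J \<Longrightarrow> \<phi> j v = 0) \<Longrightarrow> v \<in> W"
  shows "finite B \<and> card B \<le> card J"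
proof -
  define \<Phi> where "\<Phi> v = (\<Sum>j\<in>J. Poly_Mapping.single j (\<phi> j v))" for v
  have BV: "B \<subseteq> V" using B by (simp add: quot_basis_def)
  have ind: "\<forall>b\<in>S. c b = 0" if "finite S" "S \<subseteq> B" "(\<Sum>b\<in>S. scale (c b) b) \<in> W" for S c
    using B that unfolding quot_basis_def by blast
  have look: "Poly_Mapping.lookup (\<Phi> v) j = (if j \<in> J then \<phi> j v else 0)" for v j
    using J by (simp add: \<Phi>_def lookup_sum lookup_single when_def sum.delta)
  interpret \<Phi>: Vector_Spaces.linear scale pm_scale \<Phi>
    by unfold_locales (auto intro!: poly_mapping_eqI simp: look lookup_add add scl)
  have kerW: "v \<in> W" if "v \<in> V" "\<Phi> v = 0" for v
  proof (rule ker[OF that(1)])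
    fix j assume "j \<in> J" then show "\<phi> j v = 0" using look[of v j] that(2) by simp
  qed
  \<comment> \<open>Independence of the image set alone would not control \<open>card B\<close>,
    because distinct representatives could collapse to one vector.\<close>
  have inj: "inj_on \<Phi> B"
  proof (rule inj_onI, rule ccontr)
    fix b b' assume b: "b \<in> B" "b' \<in> B" "\<Phi> b = \<Phi> b'" "b \<noteq> b'"
    have "b - b' \<in> W"
      using b BV by (intro kerW subspace_diff[OF V]) (auto simp: \<Phi>.diff)
    then have "(\<Sum>x\<in>{b, b'}. scale (if x = b then 1 else -1) x) \<in> W" using b by simp
    from ind[OF _ _ this] b show False by auto
  qed
  have "pm.independent (\<Phi> ` B)"
    unfolding pm.independent_explicit_finite_subsets
  proof (intro allI ballI impI)
    fix S u v assume S: "S \<subseteq> \<Phi> ` B" "finite S"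
      and z: "(\<Sum>v\<in>S. pm_scale (u v) v) = 0" and v: "v \<in> S"
    obtain R where R: "R \<subseteq> B" "S = \<Phi> ` R" using S(1) by (metis subset_imageE)
    have iR: "inj_on \<Phi> R" using inj R(1) inj_on_subset by blast
    have fR: "finite R" using S(2) R(2) iR finite_imageD by blast
    have "\<Phi> (\<Sum>b\<in>R. scale (u (\<Phi> b)) b) = 0"
      using z unfolding R(2) sum.reindex[OF iR] by (simp add: \<Phi>.sum \<Phi>.scale)
    then have "(\<Sum>b\<in>R. scale (u (\<Phi> b)) b) \<in> W"
      using R(1) BV by (intro kerW subspace_sum[OF V] subspace_scale[OF V]) auto
    from ind[OF fR R(1) this] v R(2) show "u v = 0" by auto
  qed
  moreover have "\<Phi> ` B \<subseteq> pm.span ((\<lambda>j. Poly_Mapping.single j (1::'a)) ` J)"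
  proof (rule image_subsetI)
    fix b
    have "Poly_Mapping.single j (\<phi> j b) = pm_scale (\<phi> j b) (Poly_Mapping.single j (1::'a))" for j
      by (rule poly_mapping_eqI) (simp add: lookup_single when_def)
    then show "\<Phi> b \<in> pm.span ((\<lambda>j. Poly_Mapping.single j (1::'a)) ` J)"
      unfolding \<Phi>_def by (simp only:) (intro pm.span_sum pm.span_scale pm.span_base imageI)
  qed
  ultimately have "finite (\<Phi> ` B) \<and> card (\<Phi> ` B) \<le> card ((\<lambda>j. Poly_Mapping.single j (1::'a)) ` J)"
    using J by (intro pm.independent_span_bound) auto
  then show ?thesis
    using inj card_image_le[OF J] by (metis card_image finite_imageD le_trans)
qed

text \<open>The bound transfers to the basis picked by \<open>SOME\<close>. Finiteness matters for
  positivity, as \<open>card\<close> of an infinite set is 0; and an empty basis would force every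
  vector of \<open>V\<close> into \<open>W\<close>.\<close>

lemma (in vector_space) quot_dim_functionals:
  fixes \<phi> :: "'j \<Rightarrow> 'b \<Rightarrow> 'a"
  assumes V: "subspace V" and W: "subspace W" "W \<subseteq> V" and J: "finite J"
    and \<phi>: "\<And>j u v. \<phi> j (u + v) = \<phi> j u + \<phi> j v" "\<And>j c v. \<phi> j (scale c v) = c * \<phi> j v"
    and ker: "\<And>v. v \<in> V \<Longrightarrow> (\<And>j. j \<in> J \<Longrightarrow> \<phi> j v = 0) \<Longrightarrow> v \<in> W"
  shows "quot_dim scale V W \<le> card J" and "W \<noteq> V \<Longrightarrow> quot_dim scale V W > 0"
proof -
  define B where "B = (SOME B. quot_basis scale V W B)"
  have B: "quot_basis scale V W B"
    unfolding B_def by (rule someI_ex) (rule quot_basis_exists[OF V W])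
  have dim: "quot_dim scale V W = card B" by (simp add: quot_dim_def B_def)
  have fin: "finite B" "card B \<le> card J"
    using quot_basis_card_le[where \<phi>=\<phi>, OF B V J \<phi> ker] by auto
  show "quot_dim scale V W \<le> card J" using fin dim by simp
  show "quot_dim scale V W > 0" if "W \<noteq> V"
  proof -
    from that W(2) obtain v where v: "v \<in> V" "v \<notin> W" by auto
    have "\<exists>S c. finite S \<and> S \<subseteq> B \<and> v - (\<Sum>b\<in>S. scale (c b) b) \<in> W"
      using B v(1) unfolding quot_basis_def by blast
    then have "B \<noteq> {}" using v(2) by auto
    then show ?thesis using fin dim by (simp add: card_gt_0_iff)
  qed
qed

section \<open>Multilinear polynomials\<close>

context star_algebra begin

lemma mono_eval_cong: "(\<And>g. g \<in># gens w \<Longrightarrow> \<rho> g = \<tau> g) \<Longrightarrow> mono_eval A \<rho> w = mono_eval A \<tau> w"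
  by (induction w) auto

text \<open>A generator that occurs once lies in exactly one of the two factors of a product, and
  the value of the other factor does not change with it. So additivity is inherited from one side of
  \<open>mult\<close>.\<close>

lemma mono_eval_upd_add:
  assumes "count (gens w) h = 1" "\<And>g. \<rho> g \<in> carrier A" "u \<in> carrier A" "v \<in> carrier A"
  shows "mono_eval A (\<rho>(h := u + v)) w = mono_eval A (\<rho>(h := u)) w + mono_eval A (\<rho>(h := v)) w"
  using assms(1)
proof (induction w)
  case (Gen g) then show ?case by (auto split: if_splits)
next
  case (Mul p q)
  have closed: "mono_eval A (\<rho>(h := x)) w \<in> carrier A" if "x \<in> carrier A" for x w
    using assms that by (intro mono_eval_closed) auto
  have other: "mono_eval A (\<rho>(h := x)) w = mono_eval A \<rho> w" if "h \<notin># gens w" for w x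
    using that by (intro mono_eval_cong) auto
  from Mul.prems consider "count (gens p) h = 1" "count (gens q) h = 0"
    | "count (gens p) h = 0" "count (gens q) h = 1" by (auto simp: add_is_1)
  then show ?case
  proof cases
    case 1
    then have "h \<notin># gens q" by (simp add: not_in_iff)
    from other[OF this] 1 Mul.IH(1) show ?thesis
      using closed assms mono_eval_closed[of \<rho>]
      by (simp add: mult_add_left del: fun_upd_apply)
  next
    case 2
    then have "h \<notin># gens p" by (simp add: not_in_iff)
    from other[OF this] 2 Mul.IH(2) show ?thesis
      using closed assms mono_eval_closed[of \<rho>]
      by (simp add: mult_add_right del: fun_upd_apply)
  qed
qed

lemma mono_eval_upd_scale:
  assumes "count (gens w) h = 1" "\<And>g. \<rho> g \<in> carrier A" "u \<in> carrier A"
  shows "mono_eval A (\<rho>(h := scale A c u)) w = scale A c (mono_eval A (\<rho>(h := u)) w)"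
  using assms(1)
proof (induction w)
  case (Gen g) then show ?case by (auto split: if_splits)
next
  case (Mul p q)
  have closed: "mono_eval A (\<rho>(h := x)) w \<in> carrier A" if "x \<in> carrier A" for x w
    using assms that by (intro mono_eval_closed) auto
  have other: "mono_eval A (\<rho>(h := x)) w = mono_eval A \<rho> w" if "h \<notin># gens w" for w x
    using that by (intro mono_eval_cong) auto
  from Mul.prems consider "count (gens p) h = 1" "count (gens q) h = 0"
    | "count (gens p) h = 0" "count (gens q) h = 1" by (auto simp: add_is_1)
  then show ?case
  proof cases
    case 1
    then have "h \<notin># gens q" by (simp add: not_in_iff)
    from other[OF this] 1 Mul.IH(1) show ?thesis
      using closed assms mono_eval_closed[of \<rho>]
      by (simp add: mult_scale_left del: fun_upd_apply)
  next
    case 2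
    then have "h \<notin># gens p" by (simp add: not_in_iff)
    from other[OF this] 2 Mul.IH(2) show ?thesis
      using closed assms mono_eval_closed[of \<rho>]
      by (simp add: mult_scale_right del: fun_upd_apply)
  qed
qed

lemma poly_eval_cong_multilin:
  assumes "f \<in> multilin k m" "\<And>g. g \<in> X ` {..<k} \<union> Y ` {..<m} \<Longrightarrow> \<rho> g = \<tau> g"
  shows "poly_eval A \<rho> f = poly_eval A \<tau> f"
  unfolding poly_eval_def
proof (intro sum.cong refl arg_cong[where f="scale A _"] mono_eval_cong)
  fix w g assume "w \<in> Poly_Mapping.keys f" "g \<in># gens w"
  then have "g \<in> X ` {..<k} \<union> Y ` {..<m}" using assms(1) by (auto simp: multilin_def)
  then show "\<rho> g = \<tau> g" by (rule assms(2))
qed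

text \<open>Multilinearity lets the values be enlarged from \<open>S g\<close> to its span one
  generator at a time: with the other values fixed, the values of one generator at which
  \<open>f\<close> vanishes form a subspace.\<close>

lemma multilin_eval_zero_on_span:
  fixes S :: "gen \<Rightarrow> 'v set"
  defines "G \<equiv> \<lambda>k m. X ` {..<k} \<union> Y ` {..<m}"
  assumes f: "f \<in> multilin k m" and S: "\<And>g. S g \<subseteq> carrier A"
    and zero: "\<And>\<rho>. (\<And>g. \<rho> g \<in> carrier A) \<Longrightarrow> (\<And>g. g \<in> G k m \<Longrightarrow> \<rho> g \<in> S g) \<Longrightarrow> poly_eval A \<rho> f = 0"
    and \<rho>: "\<And>g. \<rho> g \<in> carrier A" "\<And>g. g \<in> G k m \<Longrightarrow> \<rho> g \<in> span (S g)"
  shows "poly_eval A \<rho> f = 0"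
proof -
  \<comment> \<open>\<open>H\<close> collects the generators already allowed to range over the whole
    span; the induction moves generators into \<open>H\<close>.\<close>
  have "poly_eval A \<rho> f = 0"
    if "finite H" "H \<subseteq> G k m" "\<And>g. \<rho> g \<in> carrier A" "\<And>g. g \<in> H \<Longrightarrow> \<rho> g \<in> span (S g)"
      "\<And>g. g \<in> G k m - H \<Longrightarrow> \<rho> g \<in> S g" for H \<rho>
    using that
  proof (induction H arbitrary: \<rho> rule: finite_induct)
    case empty then show ?case by (intro zero) auto
  next
    case (insert h H)
    define Z where "Z = {v \<in> carrier A. poly_eval A (\<rho>(h := v)) f = 0}"
    have cnt: "count (gens w) h = 1" if "w \<in> Poly_Mapping.keys f" for w
      using f that insert.prems(1) by (auto simp: multilin_def G_def count_mset_set')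
    have "subspace Z"
    proof (rule subspaceI)
      have sc: "poly_eval A (\<rho>(h := scale A c u)) f = scale A c (poly_eval A (\<rho>(h := u)) f)"
        if "u \<in> carrier A" for c u
        using that insert.prems(2) cnt
        by (simp add: poly_eval_def mono_eval_upd_scale scale_sum_right mult.commute)
      have ad: "poly_eval A (\<rho>(h := u + v)) f = poly_eval A (\<rho>(h := u)) f + poly_eval A (\<rho>(h := v)) f"
        if "u \<in> carrier A" "v \<in> carrier A" for u v
        using that insert.prems(2) cnt
        by (simp add: poly_eval_def mono_eval_upd_add scale_right_distrib sum.distrib)
      show "0 \<in> Z" using sc[of 0 0] subspace_0[OF subspace_carrier] by (simp add: Z_def)
      show "u + v \<in> Z" if "u \<in> Z" "v \<in> Z" for u v
        using that ad subspace_add[OF subspace_carrier] by (simp add: Z_def)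
      show "scale A c u \<in> Z" if "u \<in> Z" for c u
        using that sc subspace_scale[OF subspace_carrier] by (simp add: Z_def)
    qed
    moreover have "S h \<subseteq> Z"
    proof
      fix v assume v: "v \<in> S h"
      then have "v \<in> carrier A" using S by blast
      moreover have "poly_eval A (\<rho>(h := v)) f = 0"
        using insert.prems insert.hyps v \<open>v \<in> carrier A\<close> by (intro insert.IH) auto
      ultimately show "v \<in> Z" by (simp add: Z_def)
    qed
    ultimately have "span (S h) \<subseteq> Z" by (rule span_minimal[rotated])
    then have "\<rho> h \<in> Z" using insert.prems(3) by auto
    then show ?case by (simp add: Z_def)
  qed
  from this[of "G k m" \<rho>] show ?thesis using \<rho> by (auto simp: G_def)
qed

end

section \<open>The algebra \<open>A\<^sub>T\<close>\<close>

abbreviation pm_unit :: "'i \<Rightarrow> ('i \<Rightarrow>\<^sub>0 'k::comm_ring_1)" where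
  "pm_unit u \<equiv> Poly_Mapping.single u 1"

fun at_zdeg :: "at_idx \<Rightarrow> nat" where
  "at_zdeg (BZ i) = 1"
| "at_zdeg _ = 0"

text \<open>The weights are forced by additivity once each z has its index as weight: a raises the
  index by 1, and b takes 2T+1 back to 1. The grading is over the integers, so it counts turns
  around the cycle.\<close>

fun at_weight :: "nat \<Rightarrow> at_idx \<Rightarrow> int" where
  "at_weight T BA = 1"
| "at_weight T BB = - (2 * int T)"
| "at_weight T (BZ i) = int i"

text \<open>
  \<open>A\<^sub>T\<close> is graded by the number of factors \<open>z\<close> and by this weight, and all
  nonzero products lie in the span of the \<open>z\<^sub>i\<close>.
\<close>

lemma at_mult_graded:
  assumes "at_mult T u v \<noteq> (0 :: at_idx \<Rightarrow>\<^sub>0 'k::comm_ring_1)"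
  obtains i where "i \<in> {1..2*T+1}" "at_mult T u v = (pm_unit (BZ i) :: at_idx \<Rightarrow>\<^sub>0 'k)"
    "at_weight T (BZ i) = at_weight T u + at_weight T v" "at_zdeg u + at_zdeg v = 1"
  using assms by (cases u; cases v) (auto simp: at_mult_def split: if_splits)

lemma mult_A_T_unit: "mult (A_T T) (pm_unit u) (pm_unit v) = (at_mult T u v :: at_idx \<Rightarrow>\<^sub>0 'k::field)"
  by (simp add: A_T_def bilin_ext_def)

lemma scale_A_T [simp]: "scale (A_T T) = pm_scale"
  by (simp add: A_T_def)

lemma carrier_A_T: "p \<in> carrier (A_T T) \<longleftrightarrow> Poly_Mapping.keys p \<subseteq> at_basis T"
  by (simp add: A_T_def)

lemma pm_unit_in_carrier: "pm_unit u \<in> carrier (A_T T :: ('k::field, _) star_alg) \<longleftrightarrow> u \<in> at_basis T"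
  by (simp add: carrier_A_T)

text \<open>A product of two basis elements is zero or again a single basis element, so no sums
  arise and the degrees add up over the leaves. Only from size 2 on must the value be some z, since
  a lone generator may take the value a or b.\<close>

lemma mono_eval_unit_cases:
  fixes T :: nat and \<sigma> :: "gen \<Rightarrow> at_idx"
  defines "ev \<equiv> mono_eval (A_T T :: ('k::field, _) star_alg) (\<lambda>g. pm_unit (\<sigma> g))"
  assumes "ev w \<noteq> 0"
  shows "\<exists>u. ev w = pm_unit u \<and> at_weight T u = (\<Sum>g\<in>#gens w. at_weight T (\<sigma> g)) \<and>
     at_zdeg u = (\<Sum>g\<in>#gens w. at_zdeg (\<sigma> g)) \<and> (size (gens w) \<ge> 2 \<longrightarrow> u \<in> BZ ` {1..2*T+1})"
  using assms(2)
proof (induction w)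
  case (Gen g) then show ?case by (auto simp: ev_def)
next
  case (Mul p q)
  interpret star_algebra "A_T T :: ('k, _) star_alg" by (rule star_algebra_A_T)
  have "lin_ext g 0 = 0" for g :: "at_idx \<Rightarrow> (at_idx \<Rightarrow>\<^sub>0 'k)" by (simp add: lin_ext_def)
  then have z: "mult (A_T T) 0 x = 0" "mult (A_T T) x 0 = 0" for x :: "at_idx \<Rightarrow>\<^sub>0 'k"
    by (auto simp: A_T_def bilin_ext_def)
  from Mul.prems have "ev p \<noteq> 0" "ev q \<noteq> 0" by (auto simp: ev_def z)
  then obtain u v where u: "ev p = pm_unit u" "at_weight T u = (\<Sum>g\<in>#gens p. at_weight T (\<sigma> g))"
      "at_zdeg u = (\<Sum>g\<in>#gens p. at_zdeg (\<sigma> g))"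
    and v: "ev q = pm_unit v" "at_weight T v = (\<Sum>g\<in>#gens q. at_weight T (\<sigma> g))"
      "at_zdeg v = (\<Sum>g\<in>#gens q. at_zdeg (\<sigma> g))"
    using Mul.IH by metis
  have eq: "ev (Mul p q) = at_mult T u v" using u v by (simp add: ev_def mult_A_T_unit)
  with Mul.prems have "at_mult T u v \<noteq> (0 :: at_idx \<Rightarrow>\<^sub>0 'k)" by simp
  then obtain i where "i \<in> {1..2*T+1}" "at_mult T u v = (pm_unit (BZ i) :: at_idx \<Rightarrow>\<^sub>0 'k)"
    "at_weight T (BZ i) = at_weight T u + at_weight T v" "at_zdeg u + at_zdeg v = 1"
    by (rule at_mult_graded)
  then show ?case using eq u v by (intro exI[of _ "BZ i"]) auto
qed

text \<open>Some monomial of \<open>f\<close> has a nonzero value, and all monomials of a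
  multilinear polynomial contain the same generators. Hence the degrees of that value, which is some
  z, are sums over \<open>G\<close>.\<close>

lemma poly_eval_unit_nonzero:
  fixes f :: "'k::field free_alg"
  assumes f: "f \<in> multilin k m" and n: "k + m \<ge> 2"
    and ne: "poly_eval (A_T T) (\<lambda>g. pm_unit (\<sigma> g)) f \<noteq> 0"
  defines "G \<equiv> X ` {..<k} \<union> Y ` {..<m}"
  shows "(\<Sum>g\<in>G. at_zdeg (\<sigma> g)) = 1" and "(\<Sum>g\<in>G. at_weight T (\<sigma> g)) \<in> {1..2 * int T + 1}"
proof -
  from ne obtain w where w: "w \<in> Poly_Mapping.keys f"
    "mono_eval (A_T T :: ('k, _) star_alg) (\<lambda>g. pm_unit (\<sigma> g)) w \<noteq> 0"
    unfolding poly_eval_def by (metis (no_types, lifting) scale_A_T pm.scale_zero_right sum.neutral)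
  have g: "gens w = mset_set G" using f w(1) by (simp add: multilin_def G_def)
  have "card G = k + m"
    unfolding G_def by (subst card_Un_disjoint) (auto simp: card_image inj_on_def)
  then have "size (gens w) \<ge> 2" using g n by simp
  then obtain i where "i \<in> {1..2*T+1}" "at_weight T (BZ i) = (\<Sum>g\<in>#gens w. at_weight T (\<sigma> g))"
      "at_zdeg (BZ i) = (\<Sum>g\<in>#gens w. at_zdeg (\<sigma> g))"
    using mono_eval_unit_cases[OF w(2)] by auto
  then show "(\<Sum>g\<in>G. at_zdeg (\<sigma> g)) = 1" "(\<Sum>g\<in>G. at_weight T (\<sigma> g)) \<in> {1..2 * int T + 1}"
    by (auto simp: g sum_unfold_sum_mset)
qed

section \<open>Substitutions with a single z\<close>

fun gen_letter :: "gen \<Rightarrow> at_idx" where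
  "gen_letter (X _) = BB"
| "gen_letter (Y _) = BA"

text \<open>The parity of \<open>i\<close> is not matched to the kind of \<open>g\<close>. This
  admits substitutions that do not respect the involution, which is harmless for an upper bound on
  codimensions.\<close>

definition z_subst :: "gen \<Rightarrow> nat \<Rightarrow> gen \<Rightarrow> at_idx" where
  "z_subst g i = gen_letter(g := BZ i)"

text \<open>The degree constraint that makes almost all of the $c^*_{k,m}$ vanish.\<close>

lemma z_subst_range:
  fixes f :: "'k::field free_alg"
  assumes f: "f \<in> multilin k m" and n: "k + m \<ge> 2" and i: "i \<in> {1..2*T+1}"
    and g: "g \<in> X ` {..<k} \<union> Y ` {..<m}"
    and ne: "poly_eval (A_T T) (\<lambda>h. pm_unit (z_subst g i h)) f \<noteq> 0"
  shows "\<bar>int m - 2 * int T * int k\<bar> \<le> 4 * int T + 1"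
proof -
  define G where "G = X ` {..<k} \<union> Y ` {..<m}"
  have gG: "g \<in> G" "finite G" using g by (auto simp: G_def)
  have "(\<Sum>h\<in>G. at_weight T (gen_letter h)) =
      (\<Sum>h\<in>X ` {..<k}. at_weight T (gen_letter h)) + (\<Sum>h\<in>Y ` {..<m}. at_weight T (gen_letter h))"
    unfolding G_def by (intro sum.union_disjoint) auto
  also have "\<dots> = int m - 2 * int T * int k" by (simp add: sum.reindex inj_on_def)
  finally have "(\<Sum>h\<in>G - {g}. at_weight T (gen_letter h)) =
      int m - 2 * int T * int k - at_weight T (gen_letter g)"
    using sum.remove[OF gG(2,1), of "\<lambda>h. at_weight T (gen_letter h)"] by simp
  moreover have "(\<Sum>h\<in>G. at_weight T (z_subst g i h)) =
      int i + (\<Sum>h\<in>G - {g}. at_weight T (z_subst g i h))"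
    using sum.remove[OF gG(2,1), of "\<lambda>h. at_weight T (z_subst g i h)"] by (simp add: z_subst_def)
  moreover have "(\<Sum>h\<in>G - {g}. at_weight T (z_subst g i h)) = (\<Sum>h\<in>G - {g}. at_weight T (gen_letter h))"
    by (intro sum.cong) (auto simp: z_subst_def)
  moreover have "(\<Sum>h\<in>G. at_weight T (z_subst g i h)) \<in> {1..2 * int T + 1}"
    using poly_eval_unit_nonzero(2)[OF f n ne] by (simp add: G_def)
  ultimately have "int m - 2 * int T * int k - at_weight T (gen_letter g) + int i \<in> {1..2 * int T + 1}"
    by (simp add: algebra_simps)
  \<comment> \<open>The total weight and \<open>i\<close> differ by at most 2T, and the replaced
    letter has weight 1 or -2T. So m - 2Tk lies between -4T and 2T+1.\<close>
  then show ?thesis using i by (cases g) auto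
qed

section \<open>Reduction of identities to these substitutions\<close>

definition letter_basis :: "nat \<Rightarrow> gen \<Rightarrow> at_idx set" where
  "letter_basis T g = insert (gen_letter g) (BZ ` {1..2*T+1})"

text \<open>The involution negates the coefficient of a and fixes that of b. In characteristic zero
  -x = x forces x = 0, so a drops out of symmetric elements and b out of skew ones; every z is
  kept.\<close>

lemma sym_skew_in_span:
  fixes p :: "at_idx \<Rightarrow>\<^sub>0 'k::field_char_0"
  assumes "p \<in> (case g of X _ \<Rightarrow> sym_part (A_T T) | Y _ \<Rightarrow> skew_part (A_T T))"
  shows "p \<in> pm.span (pm_unit ` letter_basis T g)"
proof -
  have st: "star (A_T T) p = lin_ext at_star p" by (simp add: A_T_def)
  have car: "Poly_Mapping.keys p \<subseteq> at_basis T"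
    using assms by (auto simp: sym_part_def skew_part_def carrier_A_T split: gen.splits)
  have double: "x = 0" if "- x = x" for x :: 'k
  proof -
    have "x + x = 0" using that by (metis add.left_inverse)
    then have "2 * x = 0" by (simp only: mult_2)
    then show ?thesis by simp
  qed
  have "Poly_Mapping.keys p \<subseteq> letter_basis T g"
  proof (cases g)
    case [simp]: (X j)
    then have "lin_ext at_star p = p" using assms by (simp add: sym_part_def st)
    then have "- Poly_Mapping.lookup p BA = Poly_Mapping.lookup p BA"
      using lookup_star[of p BA] by (simp add: at_sign_def)
    then have "BA \<notin> Poly_Mapping.keys p" by (simp add: in_keys_iff double)
    with car show ?thesis by (auto simp: letter_basis_def at_basis_def)
  next
    case [simp]: (Y j)
    then have "lin_ext at_star p = - p" using assms by (simp add: skew_part_def st)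
    then have "- Poly_Mapping.lookup p BB = Poly_Mapping.lookup p BB"
      using lookup_star[of p BB] by (simp add: at_sign_def)
    then have "BB \<notin> Poly_Mapping.keys p" by (simp add: in_keys_iff double)
    with car show ?thesis by (auto simp: letter_basis_def at_basis_def)
  qed
  moreover have "p = (\<Sum>u\<in>Poly_Mapping.keys p. pm_scale (Poly_Mapping.lookup p u) (pm_unit u))"
    by (rule poly_mapping_eqI) (auto simp: lookup_sum lookup_single when_def in_keys_iff sum.delta if_distrib cong: if_cong)
  ultimately show ?thesis
    by (smt (verit, best) image_subset_iff pm.span_base pm.span_scale pm.span_sum subsetD imageI)
qed

text \<open>By multilinearity it suffices to substitute elements of \<open>letter_basis\<close>. If
  the value is nonzero, the z-degree lets exactly one generator take some z, and each other
  generator is left with its own letter: the substitution is a \<open>z_subst\<close>.\<close>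

lemma multilin_star_identity_criterion:
  fixes f :: "'k::field_char_0 free_alg"
  assumes f: "f \<in> multilin k m" and n: "k + m \<ge> 2"
    and zero: "\<And>g i. g \<in> X ` {..<k} \<union> Y ` {..<m} \<Longrightarrow> i \<in> {1..2*T+1} \<Longrightarrow>
      poly_eval (A_T T) (\<lambda>h. pm_unit (z_subst g i h)) f = 0"
  shows "f \<in> star_identities (A_T T)"
  unfolding star_identities_def
proof (intro CollectI allI impI, elim conjE)
  interpret star_algebra "A_T T :: ('k, _) star_alg" by (rule star_algebra_A_T)
  define G where "G = X ` {..<k} \<union> Y ` {..<m}"
  have unit: "poly_eval (A_T T) \<rho> f = 0"
    if \<rho>: "\<And>g. g \<in> G \<Longrightarrow> \<rho> g \<in> (pm_unit :: _ \<Rightarrow> _ \<Rightarrow>\<^sub>0 'k) ` letter_basis T g" for \<rho>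
  proof (rule ccontr)
    define \<sigma> where "\<sigma> g = (SOME u. u \<in> letter_basis T g \<and> \<rho> g = pm_unit u)" for g
    have \<sigma>: "\<sigma> g \<in> letter_basis T g" "\<rho> g = pm_unit (\<sigma> g)" if "g \<in> G" for g
      using \<rho>[OF that] someI_ex[of "\<lambda>u. u \<in> letter_basis T g \<and> \<rho> g = pm_unit u"]
      unfolding \<sigma>_def by blast+
    assume "poly_eval (A_T T) \<rho> f \<noteq> 0"
    moreover have "poly_eval (A_T T) \<rho> f = poly_eval (A_T T) (\<lambda>g. pm_unit (\<sigma> g)) f"
      using \<sigma> by (intro poly_eval_cong_multilin[OF f]) (simp add: G_def)
    ultimately have ne: "poly_eval (A_T T) (\<lambda>g. pm_unit (\<sigma> g)) f \<noteq> 0" by simp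
    \<comment> \<open>A sum of natural numbers equal to 1 has exactly one nonzero summand; this
      singles out the generator that takes a z.\<close>
    have "(\<Sum>g\<in>G. at_zdeg (\<sigma> g)) = 1"
      using poly_eval_unit_nonzero(1)[OF f n ne] by (simp add: G_def)
    moreover have "finite G" by (simp add: G_def)
    ultimately obtain g where g: "g \<in> G" "at_zdeg (\<sigma> g) = 1"
      and rest: "\<And>h. h \<in> G \<Longrightarrow> h \<noteq> g \<Longrightarrow> at_zdeg (\<sigma> h) = 0"
      by (metis sum_eq_1_iff)
    obtain i where i: "\<sigma> g = BZ i" using g(2) by (cases "\<sigma> g") auto
    then have iT: "i \<in> {1..2*T+1}" using \<sigma>(1)[OF g(1)] by (cases g) (auto simp: letter_basis_def)
    have "\<sigma> h = z_subst g i h" if "h \<in> G" for h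
    proof (cases "h = g")
      case False
      then have "at_zdeg (\<sigma> h) = 0" using rest that by simp
      then show ?thesis using \<sigma>(1)[OF that] False by (auto simp: letter_basis_def z_subst_def)
    qed (simp add: i z_subst_def)
    then have "poly_eval (A_T T) (\<lambda>g. pm_unit (\<sigma> g)) f = poly_eval (A_T T) (\<lambda>h. pm_unit (z_subst g i h)) f"
      by (intro poly_eval_cong_multilin[OF f]) (simp add: G_def)
    then show False using ne zero[of g i] g(1) iT by (simp add: G_def)
  qed
  fix \<rho> :: "gen \<Rightarrow> at_idx \<Rightarrow>\<^sub>0 'k"
  assume \<rho>: "\<forall>i. \<rho> (X i) \<in> sym_part (A_T T)" "\<forall>i. \<rho> (Y i) \<in> skew_part (A_T T)"
  have *: "\<rho> g \<in> (case g of X _ \<Rightarrow> sym_part (A_T T) | Y _ \<Rightarrow> skew_part (A_T T))" for g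
    using \<rho> by (cases g) auto
  show "poly_eval (A_T T) \<rho> f = 0"
  proof (rule multilin_eval_zero_on_span[OF f, where S="\<lambda>g. pm_unit ` letter_basis T g"])
    show "pm_unit ` letter_basis T g \<subseteq> carrier (A_T T :: ('k, _) star_alg)" for g
      by (cases g) (auto simp: pm_unit_in_carrier letter_basis_def at_basis_def)
    show "\<rho> g \<in> carrier (A_T T)" for g
      using *[of g] by (auto simp: sym_part_def skew_part_def split: gen.splits)
    show "\<rho> g \<in> span (pm_unit ` letter_basis T g)" for g
      using sym_skew_in_span[OF *[of g]] by simp
  qed (rule unit, simp add: G_def)
qed

section \<open>Bounds on the codimensions\<close>

lemma subspace_multilin: "pm.subspace (multilin k m :: 'k::field free_alg set)"
proof (rule pm.subspaceI)
  fix f g :: "'k free_alg" assume "f \<in> multilin k m" "g \<in> multilin k m"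
  then show "f + g \<in> multilin k m"
    using Poly_Mapping.keys_add[of f g] by (auto simp: multilin_def)
qed (auto simp: multilin_def in_keys_iff)

lemma (in star_algebra) subspace_star_identities: "pm.subspace (star_identities A)"
proof (rule pm.subspaceI)
  show "0 \<in> star_identities A" by (simp add: star_identities_def poly_eval_def)
qed (auto simp: star_identities_def poly_eval_add poly_eval_scale)

text \<open>The functionals are the coordinates of the values under all \<open>z_subst g i\<close>.
  By the criterion, a multilinear polynomial on which they all vanish is an identity, so their
  number bounds the codimension.\<close>

lemma star_codim2_A_T:
  fixes k m T :: nat
  defines "c \<equiv> star_codim2 (A_T T :: ('k::field_char_0, _) star_alg) k m"
  assumes n: "k + m \<ge> 2"
  shows "c \<le> (k + m) * (2 * T + 3) ^ 2"
    and "c \<noteq> 0 \<Longrightarrow> \<bar>int m - 2 * int T * int k\<bar> \<le> 4 * int T + 1"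
    and "\<exists>f. f \<in> multilin k m \<and> f \<notin> star_identities (A_T T :: ('k, _) star_alg) \<Longrightarrow> c > 0"
proof -
  interpret star_algebra "A_T T :: ('k, _) star_alg" by (rule star_algebra_A_T)
  define G where "G = X ` {..<k} \<union> Y ` {..<m}"
  define V where "V = (multilin k m :: 'k free_alg set)"
  define W where "W = V \<inter> star_identities (A_T T)"
  define J where "J = G \<times> {1..2*T+1} \<times> at_basis T"
  define \<phi> where "\<phi> = (\<lambda>(g, i, u). \<lambda>f :: 'k free_alg.
    Poly_Mapping.lookup (poly_eval (A_T T) (\<lambda>h. pm_unit (z_subst g i h)) f) u)"
  have c: "c = quot_dim pm_scale V W" by (simp add: c_def star_codim2_def V_def W_def)
  have V: "pm.subspace V" unfolding V_def by (rule subspace_multilin)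
  have W: "pm.subspace W" "W \<subseteq> V"
    unfolding W_def using V subspace_star_identities by (auto intro: pm.subspace_inter)
  have fin: "finite J" by (simp add: J_def G_def at_basis_def)
  have lin: "\<phi> j (u + v) = \<phi> j u + \<phi> j v" "\<phi> j (pm_scale a v) = a * \<phi> j v" for j u v a
    by (auto simp: \<phi>_def poly_eval_add poly_eval_scale lookup_add split: prod.splits)
  have letter: "z_subst g i h \<in> at_basis T" if "i \<in> {1..2*T+1}" for g i h
    using that by (cases h) (auto simp: z_subst_def at_basis_def)
  have ker: "v \<in> W" if v: "v \<in> V" "\<And>j. j \<in> J \<Longrightarrow> \<phi> j v = 0" for v
  proof -
    have "poly_eval (A_T T) (\<lambda>h. pm_unit (z_subst g i h)) v = 0" if g: "g \<in> G" "i \<in> {1..2*T+1}" for g i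
    proof -
      have "poly_eval (A_T T) (\<lambda>h. pm_unit (z_subst g i h)) v \<in> carrier (A_T T)"
        unfolding poly_eval_def using letter[OF g(2)]
        by (intro subspace_sum[OF subspace_carrier] subspace_scale[OF subspace_carrier] mono_eval_closed)
          (simp add: pm_unit_in_carrier)
      then have keys: "Poly_Mapping.keys (poly_eval (A_T T) (\<lambda>h. pm_unit (z_subst g i h)) v) \<subseteq> at_basis T"
        by (simp add: carrier_A_T)
      show ?thesis
      proof (rule poly_mapping_eqI)
        fix u
        show "Poly_Mapping.lookup (poly_eval (A_T T) (\<lambda>h. pm_unit (z_subst g i h)) v) u =
          Poly_Mapping.lookup 0 u"
          using v(2)[of "(g, i, u)"] g keys
          by (cases "u \<in> at_basis T") (auto simp: J_def \<phi>_def in_keys_iff)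
      qed
    qed
    then show ?thesis
      using multilin_star_identity_criterion[of v k m T] v(1) n by (simp add: W_def V_def G_def)
  qed
  have "card G = k + m"
    unfolding G_def by (subst card_Un_disjoint) (auto simp: card_image inj_on_def)
  moreover have "card (at_basis T) = 2 * T + 3"
    unfolding at_basis_def by (subst card_Un_disjoint) (auto simp: card_image inj_on_def)
  \<comment> \<open>The factor 2T+1 counting the indices \<open>i\<close> is rounded up to 2T+3 to
    obtain a square.\<close>
  ultimately have "card J \<le> (k + m) * ((2 * T + 3) * (2 * T + 3))"
    unfolding J_def card_cartesian_product by (intro mult_mono) auto
  moreover have "c \<le> card J"
    unfolding c by (rule pm.quot_dim_functionals(1)[where \<phi>=\<phi>, OF V W fin lin ker])
  ultimately show "c \<le> (k + m) * (2 * T + 3) ^ 2" by (simp add: power2_eq_square)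
  show "c > 0" if "\<exists>f. f \<in> multilin k m \<and> f \<notin> star_identities (A_T T :: ('k, _) star_alg)"
  proof -
    have "W \<noteq> V" using that by (auto simp: W_def V_def)
    then show ?thesis
      unfolding c using pm.quot_dim_functionals(2)[where \<phi>=\<phi>, OF V W fin lin ker] by blast
  qed
  show "\<bar>int m - 2 * int T * int k\<bar> \<le> 4 * int T + 1" if "c \<noteq> 0"
  proof (rule ccontr)
    assume far: "\<not> ?thesis"
    have "v \<in> W" if "v \<in> V" for v
      using multilin_star_identity_criterion[of v k m T] z_subst_range[of v k m _ T] far that n
      unfolding V_def W_def by blast
    \<comment> \<open>Every element of \<open>V\<close> is an identity here, so the empty family of
      functionals suffices.\<close>
    then have "quot_dim pm_scale V W \<le> card ({} :: (gen \<times> nat \<times> at_idx) set)"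
      by - (rule pm.quot_dim_functionals(1)[where \<phi>=\<phi>, OF V W _ lin], auto)
    then show False using that c by simp
  qed
qed


section \<open>A non-identity\<close>

text \<open>
  \<open>spiral T n\<close> is the left-normed word of degree \<open>n + 1\<close> running around the cycle of the \<open>z\<^sub>i\<close>
  from \<open>Y 0\<close> at $z_2$; starting there makes its degree in the \<open>X\<close> a mode of the binomial
  distribution with success probability $1/(2T+1)$.
\<close>

primrec spiral :: "nat \<Rightarrow> nat \<Rightarrow> mono" where
  "spiral T 0 = Gen (Y 0)"
| "spiral T (Suc n) = Mul (spiral T n)
    (Gen (if (n + 2) mod (2*T+1) = 0 then X (Suc n div (2*T+1)) else Y (Suc n - Suc n div (2*T+1))))"

text \<open>The quotient by 2T+1 grows by one exactly when the new degree n+2 is divisible by 2T+1,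
  which is the test by which \<open>spiral\<close> appends an \<open>X\<close> rather than a
  \<open>Y\<close>.\<close>

lemma gens_spiral:
  assumes "T \<ge> 1"
  shows "gens (spiral T n) =
    mset_set (X ` {..<(n + 1) div (2*T+1)} \<union> Y ` {..<n + 1 - (n + 1) div (2*T+1)})"
proof (induction n)
  case 0 then show ?case using assms by (simp add: lessThan_Suc)
next
  case (Suc n)
  define d where "d = 2*T+1"
  define q where "q = Suc n div d"
  have le: "q \<le> Suc n" by (simp add: q_def)
  define S where "S = X ` {..<q} \<union> Y ` {..<Suc n - q}"
  have IH: "gens (spiral T n) = mset_set S" using Suc by (simp add: q_def d_def S_def)
  have extend: ?case if "gens (spiral T (Suc n)) = add_mset g (gens (spiral T n))" "g \<notin> S"
    "Suc (Suc n) div d = r" "X ` {..<r} \<union> Y ` {..<Suc (Suc n) - r} = insert g S" for g r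
  proof -
    have "mset_set (insert g S) = add_mset g (mset_set S)"
      using that by (intro mset_set.insert) (auto simp: S_def)
    then show ?thesis
      unfolding d_def[symmetric] unfolding Suc_eq_plus1[symmetric] that(1,3,4) IH by simp
  qed
  show ?case
  proof (cases "Suc (Suc n) mod d = 0")
    case True
    show ?thesis
    proof (rule extend)
      show "gens (spiral T (Suc n)) = add_mset (X q) (gens (spiral T n))"
        using True by (simp add: q_def d_def)
      show "Suc (Suc n) div d = Suc q" using True by (simp add: q_def div_Suc)
    qed (auto simp: S_def lessThan_Suc)
  next
    case False
    show ?thesis
    proof (rule extend)
      show "gens (spiral T (Suc n)) = add_mset (Y (Suc n - q)) (gens (spiral T n))"
        using False by (simp add: q_def d_def)
      show "Suc (Suc n) div d = q" using False by (simp add: q_def div_Suc)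
      have "Suc (Suc n) - q = Suc (Suc n - q)" using le by (rule Suc_diff_le)
      then show "X ` {..<q} \<union> Y ` {..<Suc (Suc n) - q} = insert (Y (Suc n - q)) S"
        by (simp only: lessThan_Suc image_insert Un_insert_right S_def)
    qed (auto simp: S_def)
  qed
qed

text \<open>The residue of n+1 is the current position on the cycle, counted from 0. Position 2T is
  the last z, and there n+2 is divisible by 2T+1, so an \<open>X\<close>, that is b, is read exactly
  when the cycle has to close.\<close>

lemma mono_eval_spiral:
  assumes "T \<ge> 1"
  shows "mono_eval (A_T T :: ('k::field, _) star_alg) (\<lambda>h. pm_unit (z_subst (Y 0) 2 h)) (spiral T n) =
    pm_unit (BZ ((n + 1) mod (2*T+1) + 1))"
proof (induction n)
  case 0 then show ?case using assms by (simp add: z_subst_def numeral_2_eq_2)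
next
  case (Suc n)
  define d where "d = 2*T+1"
  have "d > 1" using assms by (simp add: d_def)
  define g where "g = (if (n + 2) mod d = 0 then X (Suc n div d) else Y (Suc n - Suc n div d))"
  have step: "mono_eval (A_T T :: ('k, _) star_alg) (\<lambda>h. pm_unit (z_subst (Y 0) 2 h)) (spiral T (Suc n)) =
      at_mult T (BZ (Suc n mod d + 1)) (z_subst (Y 0) 2 g)"
    using Suc by (simp add: mult_A_T_unit d_def g_def del: mod_Suc)
  have lt: "Suc n mod d \<le> 2*T" using mod_less_divisor[of d "Suc n"] by (simp add: d_def)
  show ?case
  proof (cases "Suc (Suc n) mod d = 0")
    case True
    then have "Suc n mod d = 2*T" using \<open>d > 1\<close> by (auto simp: mod_Suc d_def split: if_splits)
    then show ?thesis unfolding step using True by (simp add: g_def z_subst_def at_mult_def d_def)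
  next
    case False
    then have "Suc (Suc n) mod d = Suc (Suc n mod d)" "Suc n mod d \<noteq> 2*T"
      by (auto simp: mod_Suc d_def split: if_splits)
    \<comment> \<open>The appended \<open>Y\<close> must differ from \<open>Y 0\<close>; otherwise
      it would be sent to a second z instead of a.\<close>
    moreover have "Suc n div d < Suc n" using \<open>d > 1\<close> by (intro div_less_dividend) auto
    then have "Suc n - Suc n div d \<noteq> 0" by linarith
    moreover have "Suc n mod d < 2*T" using lt \<open>Suc n mod d \<noteq> 2*T\<close> by simp
    ultimately show ?thesis unfolding step using False by (simp add: g_def z_subst_def at_mult_def d_def)
  qed
qed

text \<open>The substitution is admissible for the involution because the z of index 2 is skew and
  is assigned to the skew generator \<open>Y 0\<close>.\<close>

lemma spiral_not_star_identity:
  assumes "T \<ge> 1"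
  shows "pm_unit (spiral T n) \<notin> star_identities (A_T T :: ('k::field, _) star_alg)"
proof
  interpret star_algebra "A_T T :: ('k, _) star_alg" by (rule star_algebra_A_T)
  define \<rho> :: "gen \<Rightarrow> at_idx \<Rightarrow>\<^sub>0 'k" where "\<rho> = (\<lambda>h. pm_unit (z_subst (Y 0) 2 h))"
  assume "pm_unit (spiral T n) \<in> star_identities (A_T T :: ('k, _) star_alg)"
  moreover have "\<rho> (X i) \<in> sym_part (A_T T :: ('k, _) star_alg)" for i
    by (auto simp: \<rho>_def z_subst_def sym_part_def A_T_def at_basis_def lin_ext_def intro!: poly_mapping_eqI)
  moreover have "\<rho> (Y i) \<in> skew_part (A_T T :: ('k, _) star_alg)" for i
    using assms by (auto simp: \<rho>_def z_subst_def skew_part_def A_T_def at_basis_def lin_ext_def lookup_single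
      when_def intro!: poly_mapping_eqI)
  ultimately have "poly_eval (A_T T) \<rho> (pm_unit (spiral T n)) = 0"
    unfolding star_identities_def by blast
  then have "pm_unit (BZ ((n + 1) mod (2*T+1) + 1)) = (0 :: at_idx \<Rightarrow>\<^sub>0 'k)"
    by (simp only: poly_eval_single mono_eval_spiral[OF assms] \<rho>_def)
  then show False by (metis lookup_single_eq lookup_zero one_neq_zero)
qed

lemma star_codim2_A_T_pos:
  assumes "T \<ge> 1" "n \<ge> 2"
  shows "star_codim2 (A_T T :: ('k::field_char_0, _) star_alg) (n div (2*T+1)) (n - n div (2*T+1)) > 0"
proof (rule star_codim2_A_T(3))
  obtain n' where n': "n = Suc n'" using assms by (cases n) auto
  show "n div (2*T+1) + (n - n div (2*T+1)) \<ge> 2" using assms by simp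
  have "pm_unit (spiral T n') \<in> multilin (n div (2*T+1)) (n - n div (2*T+1))"
    using gens_spiral[OF assms(1), of n'] by (simp add: multilin_def n')
  then show "\<exists>f. f \<in> multilin (n div (2*T+1)) (n - n div (2*T+1)) \<and>
      f \<notin> star_identities (A_T T :: ('k, _) star_alg)"
    using spiral_not_star_identity[OF assms(1)] by blast
qed

section \<open>Binomial coefficients near the mode\<close>

lemma binomial_term_le_1:
  fixes p :: real
  assumes "0 \<le> p" "p \<le> 1" "k \<le> n"
  shows "real (n choose k) * p ^ k * (1 - p) ^ (n - k) \<le> 1"
proof -
  have "real (n choose k) * p ^ k * (1 - p) ^ (n - k) \<le>
      (\<Sum>k\<le>n. real (n choose k) * p ^ k * (1 - p) ^ (n - k))"
    using assms by (intro member_le_sum) auto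
  also have "\<dots> = 1" using binomial_ring[of p "1 - p" n] by simp
  finally show ?thesis .
qed

text \<open>The ratio of consecutive terms is (n-k)/((k+1)(d-1)), which is at least 1 iff d(k+1)
  \<le> n+1. So the terms rise up to \<open>n div d\<close> and do not rise afterwards; the largest
  of n+1 terms with sum 1 is at least their average.\<close>

lemma binomial_mode_ge:
  fixes d n :: nat and p :: real
  assumes d: "d \<ge> 2" and p: "p = 1 / real d"
  defines "t \<equiv> \<lambda>k. real (n choose k) * p ^ k * (1 - p) ^ (n - k)"
  shows "t (n div d) \<ge> 1 / (real n + 1)"
proof -
  define q where "q = n div d"
  have p01: "0 < p" "p < 1" using d by (simp_all add: p)
  have ratio: "t (Suc k) * (real k + 1) * (real d - 1) = t k * (real n - real k)" if "k < n" for k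
  proof -
    define r where "r = n - Suc k"
    have r: "n - k = Suc r" using that by (simp add: r_def)
    have "Suc k * (n choose Suc k) = (n - k) * (n choose k)"
      by (simp only: binomial_absorption binomial_absorb_comp)
    then have "real (Suc k * (n choose Suc k)) = real ((n - k) * (n choose k))" by (simp only:)
    then have c: "(real k + 1) * real (n choose Suc k) = (real n - real k) * real (n choose k)"
      using that by (simp add: of_nat_diff algebra_simps)
    have pd: "p * (real d - 1) = 1 - p" using d by (simp add: p field_simps)
    have "n - Suc k = r" using r by simp
    then have "t (Suc k) * (real k + 1) * (real d - 1) =
        ((real k + 1) * real (n choose Suc k)) * p ^ k * (p * (real d - 1)) * (1 - p) ^ r"
      by (simp add: t_def algebra_simps)
    also have "\<dots> = t k * (real n - real k)" unfolding c pd by (simp add: t_def r algebra_simps)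
    finally show ?thesis .
  qed
  have nonneg: "t k \<ge> 0" for k using p01 by (simp add: t_def)
  have up: "t k \<le> t (Suc k)" if "k < q" for k
  proof -
    have "d * (k + 1) \<le> d * q" using that by (intro mult_le_mono) auto
    also have "\<dots> \<le> n" by (simp add: q_def)
    finally have "real (d * (k + 1)) \<le> real n" by (simp only: of_nat_le_iff)
    then have "real d * (real k + 1) \<le> real n" by (simp add: algebra_simps)
    moreover have "q \<le> n" by (simp add: q_def)
    then have "k < n" using that by simp
    ultimately have "(real k + 1) * (real d - 1) \<le> real n - real k" by (simp add: algebra_simps)
    then have "t k * ((real k + 1) * (real d - 1)) \<le> t k * (real n - real k)"
      by (intro mult_left_mono nonneg)
    also have "\<dots> = t (Suc k) * ((real k + 1) * (real d - 1))"
      using ratio[OF \<open>k < n\<close>] by (simp add: mult.assoc)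
    finally show ?thesis using d by (simp add: mult_le_cancel_right)
  qed
  have down: "t (Suc k) \<le> t k" if "q \<le> k" "k < n" for k
  proof -
    have "n < d * (q + 1)" using d dividend_less_times_div[of d n] by (simp add: q_def)
    also have "\<dots> \<le> d * (k + 1)" using that by simp
    \<comment> \<open>Integrality turns n < d(k+1) into n+1 \<le> d(k+1), which is exactly the
      condition for a ratio of at most 1.\<close>
    finally have "real (n + 1) \<le> real (d * (k + 1))" by (simp only: of_nat_le_iff)
    then have "real n + 1 \<le> real d * (real k + 1)" by (simp add: algebra_simps)
    then have "real n - real k \<le> (real k + 1) * (real d - 1)" by (simp add: algebra_simps)
    then have "t k * (real n - real k) \<le> t k * ((real k + 1) * (real d - 1))"
      by (intro mult_left_mono nonneg)
    then have "t (Suc k) * ((real k + 1) * (real d - 1)) \<le> t k * ((real k + 1) * (real d - 1))"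
      using ratio[OF \<open>k < n\<close>] by (simp add: mult.assoc)
    then show ?thesis using d by (simp add: mult_le_cancel_right)
  qed
  have mode: "t k \<le> t q" if "k \<le> n" for k
  proof (cases "k \<le> q")
    case True
    then show ?thesis by (induction k rule: inc_induct) (use up order_trans in blast)+
  next
    case False
    then have "q \<le> k" by simp
    then show ?thesis using that
    proof (induction k rule: dec_induct)
      case (step j) then show ?case using down[of j] by simp
    qed simp
  qed
  have "1 = (\<Sum>k\<le>n. t k)" using binomial_ring[of p "1 - p" n] by (simp add: t_def)
  also have "\<dots> \<le> (\<Sum>k\<le>n. t q)" by (intro sum_mono mode) simp
  also have "\<dots> = (real n + 1) * t q" by (simp add: add.commute)
  finally show ?thesis by (simp add: q_def field_simps)
qed

text \<open>The coefficient splits into a binomial probability, the n-th power of the claimed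
  exponent, and a correction governed by the deviation of k from the mean pn. Bounded deviation thus
  costs only a constant factor.\<close>

lemma binomial_eq_term_times_entropy:
  fixes p :: real
  assumes p: "0 < p" "p < 1" and k: "k \<le> n"
  shows "real (n choose k) = (real (n choose k) * p ^ k * (1 - p) ^ (n - k)) *
    (1 / (p powr p * (1 - p) powr (1 - p))) ^ n * ((1 - p) / p) powr (real k - p * real n)"
proof -
  have "1 / (p powr p * (1 - p) powr (1 - p)) = p powr (- p) * (1 - p) powr (- (1 - p))"
    by (simp only: powr_minus_divide) simp
  then have "(1 / (p powr p * (1 - p) powr (1 - p))) ^ n =
      p powr (- p * real n) * (1 - p) powr (- (1 - p) * real n)"
    using p by (simp only: power_mult_distrib powr_power) (simp add: mult.commute)
  moreover have "((1 - p) / p) powr (real k - p * real n) =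
      (1 - p) powr (real k - p * real n) * p powr (- (real k - p * real n))"
    using p by (simp only: powr_minus_divide powr_divide) simp
  moreover have "p ^ k = p powr real k" "(1 - p) ^ (n - k) = (1 - p) powr (real n - real k)"
    using p k by (simp_all add: powr_realpow[symmetric] of_nat_diff)
  ultimately have "p ^ k * (1 - p) ^ (n - k) * (1 / (p powr p * (1 - p) powr (1 - p))) ^ n *
        ((1 - p) / p) powr (real k - p * real n) =
      (p powr real k * (p powr (- p * real n) * p powr (- (real k - p * real n)))) *
      ((1 - p) powr (real n - real k) * ((1 - p) powr (- (1 - p) * real n) * (1 - p) powr (real k - p * real n)))"
    by (simp only: mult_ac)
  \<comment> \<open>The exponents cancel: k - pn - (k - pn) = 0 for p, and (n - k) - (1 - p)n + (k -
    pn) = 0 for 1 - p.\<close>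
  also have "\<dots> = p powr 0 * (1 - p) powr 0"
    unfolding powr_add[symmetric]
    by (intro arg_cong2[where f="(*)"] arg_cong2[where f="(powr)"] refl) (simp_all add: algebra_simps)
  also have "\<dots> = 1" using p by simp
  finally show ?thesis by (simp add: mult.assoc)
qed

section \<open>The growth rate\<close>

text \<open>The n-th roots of positive constants and of n+1 tend to 1, so both bounds have n-th
  roots tending to \<open>E\<close>.\<close>

lemma root_tendsto_if_poly_bounds:
  fixes c :: "nat \<Rightarrow> real" and E a b :: real
  assumes "E > 0" "a > 0" "b > 0"
    and lower: "\<And>n. n \<ge> N \<Longrightarrow> a * E ^ n / (real n + 1) \<le> c n"
    and upper: "\<And>n. n \<ge> N \<Longrightarrow> c n \<le> b * E ^ n * (real n + 1) ^ r"
  shows "(\<lambda>n. root n (c n)) \<longlonglongrightarrow> E"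
proof -
  have root_Suc: "(\<lambda>n. root n (real n + 1)) \<longlonglongrightarrow> 1"
  \<comment> \<open>For n \<ge> 1 one has n+1 \<le> 2n, which reduces the claim to the known limits
    for 2 and n.\<close>
  proof (rule tendsto_sandwich[where f="\<lambda>_. 1" and h="\<lambda>n. root n 2 * root n (real n)"])
    show "\<forall>\<^sub>F n in sequentially. 1 \<le> root n (real n + 1)"
      using eventually_gt_at_top[of 0] by eventually_elim simp
    show "\<forall>\<^sub>F n in sequentially. root n (real n + 1) \<le> root n 2 * root n (real n)"
      using eventually_gt_at_top[of 0] by eventually_elim (simp flip: real_root_mult)
    have "(\<lambda>n. root n 2 * root n (real n)) \<longlonglongrightarrow> 1 * 1"
      by (intro tendsto_mult LIMSEQ_root_const LIMSEQ_root) simp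
    then show "(\<lambda>n. root n 2 * root n (real n)) \<longlonglongrightarrow> 1" by simp
  qed simp
  show ?thesis
  proof (rule tendsto_sandwich[where f="\<lambda>n. root n a * E / root n (real n + 1)"
        and h="\<lambda>n. root n b * E * root n (real n + 1) ^ r"])
    have "(\<lambda>n. root n a * E / root n (real n + 1)) \<longlonglongrightarrow> 1 * E / 1"
      by (intro tendsto_intros LIMSEQ_root_const root_Suc assms) simp
    then show "(\<lambda>n. root n a * E / root n (real n + 1)) \<longlonglongrightarrow> E" by simp
    have "(\<lambda>n. root n b * E * root n (real n + 1) ^ r) \<longlonglongrightarrow> 1 * E * 1 ^ r"
      by (intro tendsto_intros LIMSEQ_root_const root_Suc assms)
    then show "(\<lambda>n. root n b * E * root n (real n + 1) ^ r) \<longlonglongrightarrow> E" by simp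
    show "\<forall>\<^sub>F n in sequentially. root n a * E / root n (real n + 1) \<le> root n (c n)"
      using eventually_ge_at_top[of "max 1 N"]
    proof eventually_elim
      case (elim n)
      then have "root n (a * E ^ n / (real n + 1)) \<le> root n (c n)"
        by (intro real_root_le_mono lower) auto
      then show ?case
        using elim assms(1) by (simp add: real_root_mult real_root_divide real_root_power_cancel)
    qed
    show "\<forall>\<^sub>F n in sequentially. root n (c n) \<le> root n b * E * root n (real n + 1) ^ r"
      using eventually_ge_at_top[of "max 1 N"]
    proof eventually_elim
      case (elim n)
      then have "root n (c n) \<le> root n (b * E ^ n * (real n + 1) ^ r)"
        by (intro real_root_le_mono upper) auto
      then show ?case
        using elim assms(1) by (simp add: real_root_mult real_root_power real_root_power_cancel)
    qed
  qed
qed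

theorem theoremB:
  fixes T :: nat and \<theta> :: real
  assumes "T \<ge> 2"
    and "\<theta> = 1 / (2 * real T + 1)"
  shows "convergent (star_exp_seq (A_T T :: ('k::field_char_0, at_idx \<Rightarrow>\<^sub>0 'k) star_alg)) \<and>
         star_exp (A_T T :: ('k, at_idx \<Rightarrow>\<^sub>0 'k) star_alg)
           = 1 / (\<theta> powr \<theta> * (1 - \<theta>) powr (1 - \<theta>))"
proof -
  define A where "A = (A_T T :: ('k, at_idx \<Rightarrow>\<^sub>0 'k) star_alg)"
  define E where "E = 1 / (\<theta> powr \<theta> * (1 - \<theta>) powr (1 - \<theta>))"
  define t where "t n k = real (n choose k) * \<theta> ^ k * (1 - \<theta>) ^ (n - k)" for n k
  have \<theta>: "0 < \<theta>" "\<theta> < 1" "\<theta> = 1 / real (2 * T + 1)" using assms by auto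
  have \<theta>_mult: "\<theta> * real ((2 * T + 1) * k) = real k" for k
    unfolding \<theta>(3) of_nat_mult by (subst mult.assoc[symmetric]) simp
  have t_nonneg: "t n k \<ge> 0" for n k using \<theta>(1,2) by (simp add: t_def)
  have E: "E > 0" using \<theta> by (simp add: E_def)
  \<comment> \<open>The base of the correction factor is at least 1, so the correction is increasing
    in the deviation k - \<theta>n.\<close>
  have base: "(1 - \<theta>) / \<theta> = 2 * real T" by (simp add: assms(2) field_simps)
  have choose: "real (n choose k) = t n k * E ^ n * (2 * real T) powr (real k - \<theta> * real n)"
    if "k \<le> n" for n k
    using binomial_eq_term_times_entropy[OF \<theta>(1,2) that] unfolding base E_def t_def .
  \<comment> \<open>A single summand suffices, at k = \<open>n div (2 * T + 1)\<close>. There k -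
    \<theta>n \<ge> -1, whence the constant 1/(2T), and the codimension is at least 1.\<close>
  have lower: "1 / (2 * real T) * E ^ n / (real n + 1) \<le> real (star_codim A n)" if n: "n \<ge> 2" for n
  proof -
    define k where "k = n div (2 * T + 1)"
    have k: "k \<le> n" by (simp add: k_def)
    have "n < (2 * T + 1) * (k + 1)"
      using dividend_less_times_div[of "2 * T + 1" n] by (simp add: k_def)
    then have "real n \<le> real ((2 * T + 1) * (k + 1))" by (simp only: of_nat_le_iff less_imp_le)
    then have "\<theta> * real n \<le> \<theta> * real ((2 * T + 1) * (k + 1))"
      using \<theta>(1) by (intro mult_left_mono) auto
    then have "real k - \<theta> * real n \<ge> -1" unfolding \<theta>_mult by simp
    then have "(2 * real T) powr (-1) \<le> (2 * real T) powr (real k - \<theta> * real n)"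
      using assms(1) by (intro powr_mono) auto
    moreover have "1 / (real n + 1) \<le> t n k"
      unfolding t_def k_def using assms(1) \<theta>(3) by (intro binomial_mode_ge) auto
    ultimately have "1 / (real n + 1) * E ^ n * (2 * real T) powr (-1) \<le> real (n choose k)"
      unfolding choose[OF k] using E t_nonneg by (intro mult_mono) auto
    also have "\<dots> \<le> real ((n choose k) * star_codim2 A k (n - k))"
      using star_codim2_A_T_pos[of T n, where 'k='k] assms(1) n by (simp add: k_def A_def Suc_le_eq)
    also have "\<dots> \<le> real (star_codim A n)"
      unfolding star_codim_def of_nat_le_iff using k
      by (intro member_le_sum[of k "{0..n}" "\<lambda>k. (n choose k) * star_codim2 A k (n - k)"]) auto
    finally show ?thesis using assms(1) by (simp add: powr_minus_divide mult_ac)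
  qed
  \<comment> \<open>The square of 2T is the correction at deviation 2. One factor n+1 counts the
    summands, and the other comes from the linear bound on each codimension.\<close>
  have upper: "real (star_codim A n) \<le> (2 * real T)\<^sup>2 * real ((2 * T + 3)\<^sup>2) * E ^ n * (real n + 1) ^ 2"
    if n: "n \<ge> 2" for n
  proof -
    have "real ((n choose k) * star_codim2 A k (n - k)) \<le> E ^ n * (2 * real T)\<^sup>2 * real (n * (2 * T + 3)\<^sup>2)"
      if k: "k \<le> n" for k
    proof (cases "star_codim2 A k (n - k) = 0")
      case False
      have n2: "k + (n - k) \<ge> 2" using k n by simp
      have le: "real (star_codim2 A k (n - k)) \<le> real (n * (2 * T + 3)\<^sup>2)"
        using star_codim2_A_T(1)[OF n2, of T, where 'k='k] k by (simp only: of_nat_le_iff A_def) simp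
      have "\<bar>int (n - k) - 2 * int T * int k\<bar> \<le> 4 * int T + 1"
        using star_codim2_A_T(2)[OF n2, of T, where 'k='k] False by (simp add: A_def)
      \<comment> \<open>The constant 4T+1 is rounded up to 2(2T+1), so that multiplying by \<theta>
        gives the deviation bound k - \<theta>n \<le> 2.\<close>
      then have "int ((2 * T + 1) * k) \<le> int (n + (2 * T + 1) * 2)"
        using k by (simp add: of_nat_diff algebra_simps)
      then have "real ((2 * T + 1) * k) \<le> real (n + (2 * T + 1) * 2)" by (simp only: of_nat_le_iff)
      then have "\<theta> * real ((2 * T + 1) * k) \<le> \<theta> * real n + \<theta> * real ((2 * T + 1) * 2)"
        using \<theta>(1) by (simp only: distrib_left[symmetric] of_nat_add[symmetric] mult_le_cancel_left_pos)
      then have "real k - \<theta> * real n \<le> 2" unfolding \<theta>_mult by simp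
      then have "(2 * real T) powr (real k - \<theta> * real n) \<le> (2 * real T) powr 2"
        using assms(1) by (intro powr_mono) auto
      moreover have "t n k \<le> 1" unfolding t_def using \<theta> k by (intro binomial_term_le_1) auto
      ultimately have "real (n choose k) \<le> 1 * E ^ n * (2 * real T) powr 2"
        unfolding choose[OF k] using E t_nonneg by (intro mult_mono) auto
      then have "real (n choose k) \<le> E ^ n * (2 * real T)\<^sup>2" using assms(1) by simp
      with le show ?thesis unfolding of_nat_mult[of "n choose k"] by (intro mult_mono) auto
    qed (use E in simp)
    then have "real (star_codim A n) \<le> (\<Sum>k=0..n. E ^ n * (2 * real T)\<^sup>2 * real (n * (2 * T + 3)\<^sup>2))"
      unfolding star_codim_def of_nat_sum by (intro sum_mono) auto
    also have "\<dots> = (2 * real T)\<^sup>2 * real ((2 * T + 3)\<^sup>2) * E ^ n * ((real n + 1) * real n)"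
      by (simp add: mult_ac)
    also have "\<dots> \<le> (2 * real T)\<^sup>2 * real ((2 * T + 3)\<^sup>2) * E ^ n * (real n + 1) ^ 2"
      using E by (intro mult_left_mono) (auto simp: power2_eq_square)
    finally show ?thesis .
  qed
  have "star_exp_seq A \<longlonglongrightarrow> E"
    unfolding star_exp_seq_def
    by (rule root_tendsto_if_poly_bounds[OF E _ _ lower upper]) (use assms(1) in auto)
  then show ?thesis
    unfolding star_exp_def A_def[symmetric] E_def[symmetric] by (auto simp: convergent_def limI)
qed

end
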